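(* Let $V$ be a finite set of sites, and let $\mathcal{A}_1$ and $\mathcal{A}_0$ be finite collections of nonempty subsets of $V$. For $S\in\{-1,1\}^V$ and $A\subset V$ put $S_A=\prod_{i\in A}S_i$. Let $(x_A)_{A\in\mathcal{A}_1}$ and $(x_B)_{B\in\mathcal{A}_0}$ be nonnegative reals, and let $(J_A)_{A\in\mathcal{A}_1}$, $(J_B)_{B\in\mathcal{A}_0}$ be independent standard Gaussian random variables. Define $$Z_1=\sum_{S\in\{-1,1\}^V}\exp\Big(\sum_{A\in\mathcal{A}_1}(\sqrt{x_A}J_A+x_A)S_A\Big),\qquad Z_0=\sum_{S\in\{-1,1\}^V}\exp\Big(\sum_{B\in\mathcal{A}_0}(\sqrt{x_B}J_B+x_B)S_B\Big),$$ and for any function $f$ of $S$ let $\langle f\rangle_0=Z_0^{-1}\sum_{S}f(S)\exp\big(\sum_{B\in\mathcal{A}_0}(\sqrt{x_B}J_B+x_B)S_B\big)$ be the Gibbs average with respect to $Z_0$. Then $$\mathbb{E}[\log Z_1]\ \ge\ \mathbb{E}[\log Z_0]+\mathbb{E}\left[\frac12\sum_{A\in\mathcal{A}_1}x_A\big(1+\langle S_A\rangle_0\big)-\frac12\sum_{B\in\mathcal{A}_0}x_B\big(1+\langle S_B\rangle_0\big)\right],$$ where $\mathbb{E}$ denotes expectation over all the Gaussian variables.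
   Context: Each of $Z_1,Z_0$ is the partition function of an Ising spin-glass model on the Nishimori line written in the parametrization $\beta_A=\sqrt{x_A}/\sigma_A$, $J_{A0}=\sigma_A\sqrt{x_A}$: i.e. $Z=\sum_S\exp(\sum_A\beta_A J'_A S_A)$ with $J'_A$ independent Gaussian of mean $J_{A0}$ and variance $\sigma_A^2>0$, satisfying $\beta_A=J_{A0}/\sigma_A^2$; $\mathbb{E}[\log Z]$ depends only on the $x_A$. *)

theory Defs
  imports "HOL-Probability.Probability"
begin

definition spin_configs :: "'v set \<Rightarrow> ('v \<Rightarrow> real) set" where
  "spin_configs V = PiE V (\<lambda>_. {-1, 1})"

definition boltz :: "'v set set \<Rightarrow> ('v set \<Rightarrow> real) \<Rightarrow> ('v set \<Rightarrow> real) \<Rightarrow> ('v \<Rightarrow> real) \<Rightarrow> real" where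
  "boltz As x J S = exp (\<Sum>A\<in>As. (sqrt (x A) * J A + x A) * (\<Prod>i\<in>A. S i))"

definition part_fun :: "'v set \<Rightarrow> 'v set set \<Rightarrow> ('v set \<Rightarrow> real) \<Rightarrow> ('v set \<Rightarrow> real) \<Rightarrow> real" where
  "part_fun V As x J = (\<Sum>S\<in>spin_configs V. boltz As x J S)"

definition gibbs_avg :: "'v set \<Rightarrow> 'v set set \<Rightarrow> ('v set \<Rightarrow> real) \<Rightarrow> ('v set \<Rightarrow> real)
    \<Rightarrow> (('v \<Rightarrow> real) \<Rightarrow> real) \<Rightarrow> real" where
  "gibbs_avg V As x J f = (\<Sum>S\<in>spin_configs V. f S * boltz As x J S) / part_fun V As x J"

definition gauss_env :: "'v set set \<Rightarrow> 'v set set \<Rightarrow> ('v set + 'v set \<Rightarrow> real) measure" where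
  "gauss_env A1 A0 = PiM (Inl ` A1 \<union> Inr ` A0) (\<lambda>_. std_normal_distribution)"

end

theory Submission
  imports Defs
begin

text \<open>
  Run the couplings along \<^term>\<open>x1 * (sin t)\<^sup>2\<close> and \<^term>\<open>x0 * (cos t)\<^sup>2\<close>,
  \<^term>\<open>0 \<le> t \<and> t \<le> pi / 2\<close>. By a Gaussian shift and the gauge symmetry of the configurations,
  the planted expectation of a gauge invariant function \<open>f\<close> is an expectation of \<open>f * Z\<close> over
  centred Gaussians, where \<open>Z\<close> sums the likelihood ratios of all configurations; these solve a
  backward heat equation. Hence the expected \<open>ln Z\<close> becomes that of \<open>Z ln Z\<close>, whose
  gradient in the squared couplings consists of the expectations of \<open>m\<^sub>k\<^sup>2 Z\<close> (up to the
  factor 1/2), and whose Hessian consists of the expectations of the squared Gibbs covariances. The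
  latter is positive semidefinite, so the expected \<open>ln Z\<close> is convex in the squared couplings and
  lies above its tangent at the \<open>x0\<close> endpoint.
\<close>

section \<open>Differentiation under the integral sign\<close>

text \<open>Indices are tagged by \<open>Inl\<close> and \<open>Inr\<close>, so a set lying in both
  collections carries two independent couplings, and both families act at once along the path. As
  sin^2 + cos^2 = 1, the squared couplings run along a straight segment, in direction
  \<open>x1\<close> on the left indices and \<open>- x0\<close> on the right ones. The left
  couplings vanish at the start, but the gradient there still involves the averages of their spin
  products; these are the <S_A>_0 with A in \<open>A1\<close>. The claim contains first powers of
  averages, the gradient contains squares: under the planted law both have the same expectation, and
  this is where the gauge symmetry is spent a second time. The summand 1 in 1 + <S_A>_0 does not
  come from the gradient. It comes from the likelihood ratios, whose normalisation differs from the
  Boltzmann weights by a factor exp(- x_A / 2) for each coupling. Passing to centred Gaussians makes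
  the underlying law independent of the couplings. All dependence on time then sits in the weights,
  and one second-order computation serves both for Z ln Z and for its gradient.\<close>

lemma has_real_derivative_lebesgue_integral:
  fixes f f' :: "real \<Rightarrow> 'a \<Rightarrow> real"
  assumes t0: "t0 \<in> {a<..<b}"
    and int: "\<And>t. t \<in> {a<..<b} \<Longrightarrow> integrable M (f t)"
    and deriv: "\<And>t x. t \<in> {a<..<b} \<Longrightarrow> x \<in> space M \<Longrightarrow>
      ((\<lambda>t. f t x) has_real_derivative f' t x) (at t)"
    and bound: "\<And>t x. t \<in> {a<..<b} \<Longrightarrow> x \<in> space M \<Longrightarrow> \<bar>f' t x\<bar> \<le> g x"
    and g: "integrable M g"
    and meas: "f' t0 \<in> borel_measurable M"
  shows "((\<lambda>t. \<integral>x. f t x \<partial>M) has_real_derivative (\<integral>x. f' t0 x \<partial>M)) (at t0)"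
proof -
  have "((\<lambda>t. ((\<integral>x. f t x \<partial>M) - (\<integral>x. f t0 x \<partial>M)) / (t - t0)) \<longlongrightarrow> (\<integral>x. f' t0 x \<partial>M))
      (at t0 within {a<..<b})"
    unfolding tendsto_at_iff_sequentially
  proof (intro allI impI)
    fix X :: "nat \<Rightarrow> real"
    assume X: "\<forall>i. X i \<in> {a<..<b} - {t0}" and lim: "X \<longlonglongrightarrow> t0"
    let ?q = "\<lambda>i x. (f (X i) x - f t0 x) / (X i - t0)"
    have "(\<lambda>i. \<integral>x. ?q i x \<partial>M) \<longlonglongrightarrow> (\<integral>x. f' t0 x \<partial>M)"
    proof (rule integral_dominated_convergence)
      show "f' t0 \<in> borel_measurable M" by fact
      show "integrable M g" by fact
      show "?q i \<in> borel_measurable M" for i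
        using X int[of "X i"] int[OF t0] by (auto intro!: borel_measurable_divide borel_measurable_diff)
      show "AE x in M. (\<lambda>i. ?q i x) \<longlonglongrightarrow> f' t0 x"
      proof (rule AE_I2)
        fix x assume x: "x \<in> space M"
        have "((\<lambda>t. (f t x - f t0 x) / (t - t0)) \<longlongrightarrow> f' t0 x) (at t0)"
          using deriv[OF t0 x] by (simp add: has_field_derivative_iff)
        then have "((\<lambda>t. (f t x - f t0 x) / (t - t0)) \<longlongrightarrow> f' t0 x) (at t0 within UNIV)" by simp
        then show "(\<lambda>i. ?q i x) \<longlonglongrightarrow> f' t0 x"
          unfolding tendsto_at_iff_sequentially using X lim by (auto simp: o_def)
      qed
      show "AE x in M. norm (?q i x) \<le> g x" for i
      proof (rule AE_I2)
        fix x assume x: "x \<in> space M"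
        have Xi: "X i \<in> {a<..<b}" "X i \<noteq> t0" using X by auto
        \<comment> \<open>The mean value theorem turns the bound on the derivative into a bound on
          all difference quotients, so \<open>g\<close> dominates them along the sequence.\<close>
        have "norm (f (X i) x - f t0 x) \<le> g x * norm (X i - t0)"
          by (rule field_differentiable_bound[of "{a<..<b}" "\<lambda>t. f t x" "\<lambda>t. f' t x"])
            (use Xi t0 deriv x bound in \<open>auto intro: has_field_derivative_at_within\<close>)
        then show "norm (?q i x) \<le> g x"
          using Xi(2) by (simp add: norm_divide divide_le_eq)
      qed
    qed
    moreover have "(\<integral>x. ?q i x \<partial>M) = ((\<integral>x. f (X i) x \<partial>M) - (\<integral>x. f t0 x \<partial>M)) / (X i - t0)" for i
    proof -
      have "X i \<in> {a<..<b}" using X by blast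
      then show ?thesis using int[of "X i"] int[OF t0] by (simp add: Bochner_Integration.integral_diff)
    qed
    ultimately show "((\<lambda>t. ((\<integral>x. f t x \<partial>M) - (\<integral>x. f t0 x \<partial>M)) / (t - t0)) \<circ> X)
        \<longlonglongrightarrow> (\<integral>x. f' t0 x \<partial>M)"
      by (simp only: o_def)
  qed
  then show ?thesis
    using t0 at_within_open[of t0 "{a<..<b}"] by (simp add: has_field_derivative_iff)
qed

section \<open>Gaussian shifts\<close>

abbreviation std_normal_PiM :: "'k set \<Rightarrow> ('k \<Rightarrow> real) measure" where
  "std_normal_PiM K \<equiv> PiM K (\<lambda>_. std_normal_distribution)"

lemma prob_space_std_normal: "prob_space std_normal_distribution"
  by (simp add: prob_space_normal_density)

text \<open>Completing the square shows that the exponential tilt of the standard normal is the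
  normal law with mean \<open>c\<close>. The sign \<open>s\<close> leaves no trace because the
  standard normal is symmetric; carrying it along is what later makes gauge flips of the noise
  free.\<close>

lemma distr_std_normal_affine:
  assumes s: "\<bar>s\<bar> = 1"
  shows "distr std_normal_distribution borel (\<lambda>y. s * y + c)
    = density std_normal_distribution (\<lambda>y. exp (c * y - c\<^sup>2 / 2))"
proof -
  interpret prob_space std_normal_distribution by (rule prob_space_std_normal)
  have "distributed std_normal_distribution lborel (\<lambda>x. x) std_normal_density"
    by (auto simp: distributed_def distr_id2)
  from normal_density_affine[OF this, of s c] s
  have "distributed std_normal_distribution lborel (\<lambda>y. c + s * y) (normal_density c 1)"
    by fastforce
  then have "distr std_normal_distribution lborel (\<lambda>y. c + s * y) = density lborel (normal_density c 1)"
    by (simp add: distributed_def)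
  moreover have "distr std_normal_distribution borel (\<lambda>y. s * y + c)
      = distr std_normal_distribution lborel (\<lambda>y. c + s * y)"
    by (intro distr_cong) (auto simp: add.commute)
  moreover have "density std_normal_distribution (\<lambda>y. exp (c * y - c\<^sup>2 / 2))
      = density lborel (normal_density c 1)"
  proof -
    have "std_normal_density y * exp (c * y - c\<^sup>2 / 2) = normal_density c 1 y" for y
      unfolding normal_density_def
      by (simp add: exp_add[symmetric] power2_diff field_simps)
    then show ?thesis
      by (subst density_density_eq) (auto simp: ennreal_mult[symmetric] intro!: density_cong)
  qed
  ultimately show ?thesis by simp
qed

text \<open>Both measures agree on boxes with the product of the tilted one-dimensional laws, and a
  product measure is determined by its values on boxes.\<close>

lemma distr_std_normal_PiM_affine:
  fixes s c :: "'k \<Rightarrow> real"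
  assumes K: "finite K" and s: "\<And>k. k \<in> K \<Longrightarrow> \<bar>s k\<bar> = 1"
  shows "distr (std_normal_PiM K) (std_normal_PiM K) (\<lambda>J. \<lambda>k\<in>K. s k * J k + c k)
    = density (std_normal_PiM K) (\<lambda>J. exp (\<Sum>k\<in>K. c k * J k - (c k)\<^sup>2 / 2))"
    (is "?L = ?R")
proof -
  let ?N = "std_normal_distribution"
  \<comment> \<open>Outside \<open>K\<close> the shift is set to 0, so that the factor is a
    probability measure at every index, as the locale of product measures demands.\<close>
  let ?\<nu> = "\<lambda>k. density ?N (\<lambda>y. exp ((if k \<in> K then c k else 0) * y - (if k \<in> K then c k else 0)\<^sup>2 / 2))"
  have \<nu>: "distr ?N borel (\<lambda>y. s k * y + c k) = ?\<nu> k" if "k \<in> K" for k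
    using that distr_std_normal_affine[OF s, of k "c k"] by simp
  have ps: "prob_space (?\<nu> k)" for k
  proof (cases "k \<in> K")
    case True
    have "prob_space (distr ?N borel (\<lambda>y. s k * y + c k))"
      by (intro prob_space.prob_space_distr prob_space_std_normal) simp
    then show ?thesis using \<nu>[OF True] by simp
  next
    case False
    have "prob_space (distr ?N borel (\<lambda>y. 1 * y + 0))"
      by (intro prob_space.prob_space_distr prob_space_std_normal) simp
    then show ?thesis using False by (subst (asm) distr_std_normal_affine) simp_all
  qed
  interpret nu: product_sigma_finite ?\<nu>
    by (intro product_sigma_finite.intro prob_space_imp_sigma_finite ps)
  interpret N: product_sigma_finite "\<lambda>_::'k. ?N"
    by (intro product_sigma_finite.intro prob_space_imp_sigma_finite prob_space_std_normal)
  have sets: "sets (std_normal_PiM K) = sets (PiM K ?\<nu>)"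
    by (rule sets_PiM_cong) auto
  have "?L = PiM K ?\<nu>"
  proof (rule nu.PiM_eqI[OF K])
    show "sets ?L = sets (PiM K ?\<nu>)" using sets by simp
    fix A assume A: "\<And>i. i \<in> K \<Longrightarrow> A i \<in> sets (?\<nu> i)"
    have A': "A i \<in> sets borel" if "i \<in> K" for i using A[OF that] by simp
    have "emeasure ?L (Pi\<^sub>E K A)
        = emeasure (std_normal_PiM K) ((\<lambda>J. \<lambda>k\<in>K. s k * J k + c k) -` Pi\<^sub>E K A \<inter> space (std_normal_PiM K))"
      using A' K by (intro emeasure_distr) (auto intro!: sets_PiM_I_finite)
    also have "(\<lambda>J. \<lambda>k\<in>K. s k * J k + c k) -` Pi\<^sub>E K A \<inter> space (std_normal_PiM K)
        = (\<Pi>\<^sub>E k\<in>K. (\<lambda>y. s k * y + c k) -` A k)"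
      by (auto simp: space_PiM PiE_iff)
    also have "emeasure (std_normal_PiM K) \<dots> = (\<Prod>k\<in>K. emeasure ?N ((\<lambda>y. s k * y + c k) -` A k))"
      by (rule N.emeasure_PiM[OF K]) (use A' in \<open>auto intro!: measurable_sets_borel[of _ borel]\<close>)
    also have "\<dots> = (\<Prod>k\<in>K. emeasure (?\<nu> k) (A k))"
    proof (intro prod.cong refl)
      fix k assume k: "k \<in> K"
      show "emeasure ?N ((\<lambda>y. s k * y + c k) -` A k) = emeasure (?\<nu> k) (A k)"
        unfolding \<nu>[OF k, symmetric] using A'[OF k] by (subst emeasure_distr) auto
    qed
    finally show "emeasure ?L (Pi\<^sub>E K A) = (\<Prod>k\<in>K. emeasure (?\<nu> k) (A k))" .
  qed
  also have "PiM K ?\<nu> = ?R"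
  proof (rule nu.PiM_eqI[OF K, symmetric])
    show "sets ?R = sets (PiM K ?\<nu>)" using sets by simp
    fix A assume A: "\<And>i. i \<in> K \<Longrightarrow> A i \<in> sets (?\<nu> i)"
    have A': "A i \<in> sets borel" if "i \<in> K" for i using A[OF that] by simp
    have PA: "Pi\<^sub>E K A \<in> sets (std_normal_PiM K)"
      using A' K by (auto intro!: sets_PiM_I_finite)
    have "emeasure ?R (Pi\<^sub>E K A)
        = (\<integral>\<^sup>+ J. ennreal (exp (\<Sum>k\<in>K. c k * J k - (c k)\<^sup>2 / 2)) * indicator (Pi\<^sub>E K A) J \<partial>std_normal_PiM K)"
      by (rule emeasure_density) (use PA in auto)
    also have "\<dots> = (\<integral>\<^sup>+ J. (\<Prod>k\<in>K. ennreal (exp (c k * J k - (c k)\<^sup>2 / 2)) * indicator (A k) (J k)) \<partial>std_normal_PiM K)"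
    proof (intro nn_integral_cong)
      fix J assume "J \<in> space (std_normal_PiM K)"
      then have "indicator (Pi\<^sub>E K A) J = (\<Prod>k\<in>K. indicator (A k) (J k) :: ennreal)"
        using K by (auto simp: space_PiM PiE_iff indicator_def prod.neutral intro!: prod_zero[symmetric])
      then show "ennreal (exp (\<Sum>k\<in>K. c k * J k - (c k)\<^sup>2 / 2)) * indicator (Pi\<^sub>E K A) J
          = (\<Prod>k\<in>K. ennreal (exp (c k * J k - (c k)\<^sup>2 / 2)) * indicator (A k) (J k))"
        using K by (simp add: exp_sum prod.distrib prod_ennreal)
    qed
    also have "\<dots> = (\<Prod>k\<in>K. \<integral>\<^sup>+ y. ennreal (exp (c k * y - (c k)\<^sup>2 / 2)) * indicator (A k) y \<partial>?N)"
      by (rule N.product_nn_integral_prod[OF K]) (use A' in auto)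
    also have "\<dots> = (\<Prod>k\<in>K. emeasure (?\<nu> k) (A k))"
      by (intro prod.cong refl, subst emeasure_density) (use A' in auto)
    finally show "emeasure ?R (Pi\<^sub>E K A) = (\<Prod>k\<in>K. emeasure (?\<nu> k) (A k))" .
  qed
  finally show ?thesis .
qed

lemma integral_std_normal_PiM_affine:
  fixes s c :: "'k \<Rightarrow> real" and \<Phi> :: "('k \<Rightarrow> real) \<Rightarrow> real"
  assumes K: "finite K" and s: "\<And>k. k \<in> K \<Longrightarrow> \<bar>s k\<bar> = 1"
    and [measurable]: "\<Phi> \<in> borel_measurable (std_normal_PiM K)"
  shows "(\<integral>J. \<Phi> (\<lambda>k\<in>K. s k * J k + c k) \<partial>std_normal_PiM K)
    = (\<integral>J. \<Phi> J * exp (\<Sum>k\<in>K. c k * J k - (c k)\<^sup>2 / 2) \<partial>std_normal_PiM K)"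
proof -
  have "(\<integral>J. \<Phi> (\<lambda>k\<in>K. s k * J k + c k) \<partial>std_normal_PiM K)
      = (\<integral>J. \<Phi> J \<partial>distr (std_normal_PiM K) (std_normal_PiM K) (\<lambda>J. \<lambda>k\<in>K. s k * J k + c k))"
    by (subst integral_distr) auto
  also have "\<dots> = (\<integral>J. exp (\<Sum>k\<in>K. c k * J k - (c k)\<^sup>2 / 2) *\<^sub>R \<Phi> J \<partial>std_normal_PiM K)"
    by (subst distr_std_normal_PiM_affine[OF K s], assumption, subst integral_density) auto
  finally show ?thesis by (simp add: mult.commute)
qed

section \<open>Exponentially bounded functions and integration by parts\<close>

text \<open>Dominated by \<open>exp (D * y) + exp (- D * y)\<close>; after completing the square
  each summand is integrated as a multiple of a shifted normal density.\<close>

lemma integrable_exp_abs_std_normal: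
  "integrable std_normal_distribution (\<lambda>y. exp (D * \<bar>y\<bar>))"
proof -
  have *: "integrable std_normal_distribution (\<lambda>y. exp (d * y))" for d :: real
  proof -
    have "std_normal_density y * exp (d * y) = exp (d\<^sup>2 / 2) * normal_density d 1 y" for y
      unfolding normal_density_def
      by (simp add: exp_add[symmetric] power2_diff field_simps)
    then show ?thesis
      by (subst integrable_density) (auto intro!: integrable_mult_right)
  qed
  have "exp (D * \<bar>y\<bar>) \<le> \<bar>exp (D * y) + exp (- D * y)\<bar>" for y
    by (cases "0 \<le> y") (simp_all add: abs_of_pos add_pos_pos)
  then show ?thesis
    by (intro Bochner_Integration.integrable_bound[OF Bochner_Integration.integrable_add[OF *[of D] *[of "-D"]]])
      auto
qed

text \<open>The bound is uniform in the parameter \<open>t\<close>, which yields a dominating function for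
  differentiation under the integral.\<close>

definition exp_bounded :: "'k set \<Rightarrow> ('p \<Rightarrow> ('k \<Rightarrow> real) \<Rightarrow> real) \<Rightarrow> bool" where
  "exp_bounded K f \<longleftrightarrow>
    (\<exists>C D. 0 \<le> C \<and> 0 \<le> D \<and> (\<forall>t J. \<bar>f t J\<bar> \<le> C * exp (D * (\<Sum>k\<in>K. \<bar>J k\<bar>))))"

lemma exp_boundedI:
  assumes "\<And>t J. \<bar>f t J\<bar> \<le> C * exp (D * (\<Sum>k\<in>K. \<bar>J k\<bar>))"
  shows "exp_bounded K f"
  unfolding exp_bounded_def
proof (intro exI conjI allI)
  fix t J
  have "\<bar>f t J\<bar> \<le> C * exp (D * (\<Sum>k\<in>K. \<bar>J k\<bar>))" by (rule assms)
  also have "\<dots> \<le> \<bar>C\<bar> * exp (\<bar>D\<bar> * (\<Sum>k\<in>K. \<bar>J k\<bar>))"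
    by (intro mult_mono) (auto intro!: mult_right_mono sum_nonneg)
  finally show "\<bar>f t J\<bar> \<le> \<bar>C\<bar> * exp (\<bar>D\<bar> * (\<Sum>k\<in>K. \<bar>J k\<bar>))" .
qed auto

lemma exp_boundedE:
  assumes "exp_bounded K f"
  obtains C D where "0 \<le> C" "0 \<le> D" "\<And>t J. \<bar>f t J\<bar> \<le> C * exp (D * (\<Sum>k\<in>K. \<bar>J k\<bar>))"
  using assms unfolding exp_bounded_def by blast

section \<open>Closure properties of exponential bounds\<close>

lemma exp_bounded_mono:
  assumes "exp_bounded K g" "\<And>t J. \<bar>f t J\<bar> \<le> \<bar>g t J\<bar>"
  shows "exp_bounded K f"
  using assms(1)
proof (rule exp_boundedE)
  fix C D assume "\<And>t J. \<bar>g t J\<bar> \<le> C * exp (D * (\<Sum>k\<in>K. \<bar>J k\<bar>))"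
  then show ?thesis by (intro exp_boundedI order_trans[OF assms(2)])
qed

lemma exp_bounded_bounded:
  assumes "\<And>t J. \<bar>f t J\<bar> \<le> B"
  shows "exp_bounded K f"
  by (rule exp_boundedI[where C = B and D = 0]) (simp add: assms)

lemma exp_bounded_const: "exp_bounded K (\<lambda>t J. a)"
  by (rule exp_bounded_bounded[where B = "\<bar>a\<bar>"]) simp

lemma exp_bounded_reindex: "exp_bounded K f \<Longrightarrow> exp_bounded K (\<lambda>t. f (r t))"
  unfolding exp_bounded_def by blast

lemma exp_bounded_component:
  assumes "finite K" "k \<in> K"
  shows "exp_bounded K (\<lambda>t J. J k)"
proof (rule exp_boundedI[where C = 1 and D = 1])
  fix J :: "'a \<Rightarrow> real"
  have "\<bar>J k\<bar> \<le> (\<Sum>k\<in>K. \<bar>J k\<bar>)" using assms by (intro member_le_sum) auto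
  also have "\<dots> \<le> exp (\<Sum>k\<in>K. \<bar>J k\<bar>)" using exp_ge_add_one_self[of "\<Sum>k\<in>K. \<bar>J k\<bar>"] by linarith
  finally show "\<bar>J k\<bar> \<le> 1 * exp (1 * (\<Sum>k\<in>K. \<bar>J k\<bar>))" by simp
qed

lemma exp_bounded_add:
  fixes K :: "'k set"
  assumes "exp_bounded K f" "exp_bounded K g"
  shows "exp_bounded K (\<lambda>t J. f t J + g t J)"
proof -
  from assms obtain C D C' D' where *: "0 \<le> C" "0 \<le> D" "0 \<le> C'" "0 \<le> D'"
    "\<And>t J. \<bar>f t J\<bar> \<le> C * exp (D * (\<Sum>k\<in>K. \<bar>J k\<bar>))"
    "\<And>t J. \<bar>g t J\<bar> \<le> C' * exp (D' * (\<Sum>k\<in>K. \<bar>J k\<bar>))"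
    by (metis exp_boundedE)
  show ?thesis
  proof (rule exp_boundedI)
    fix t and J :: "'k \<Rightarrow> real"
    let ?s = "\<Sum>k\<in>K. \<bar>J k\<bar>"
    have s: "0 \<le> ?s" by (simp add: sum_nonneg)
    have "C * exp (D * ?s) \<le> C * exp ((D + D') * ?s)"
      using * s by (intro mult_left_mono) (auto intro!: mult_right_mono)
    moreover have "C' * exp (D' * ?s) \<le> C' * exp ((D + D') * ?s)"
      using * s by (intro mult_left_mono) (auto intro!: mult_right_mono)
    ultimately show "\<bar>f t J + g t J\<bar> \<le> (C + C') * exp ((D + D') * ?s)"
      using *(5,6)[of t J] unfolding distrib_right[of C] by linarith
  qed
qed

lemma exp_bounded_mult:
  fixes K :: "'k set"
  assumes "exp_bounded K f" "exp_bounded K g"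
  shows "exp_bounded K (\<lambda>t J. f t J * g t J)"
proof -
  from assms obtain C D C' D' where *: "0 \<le> C" "0 \<le> D" "0 \<le> C'" "0 \<le> D'"
    "\<And>t J. \<bar>f t J\<bar> \<le> C * exp (D * (\<Sum>k\<in>K. \<bar>J k\<bar>))"
    "\<And>t J. \<bar>g t J\<bar> \<le> C' * exp (D' * (\<Sum>k\<in>K. \<bar>J k\<bar>))"
    by (metis exp_boundedE)
  show ?thesis
  proof (rule exp_boundedI)
    fix t and J :: "'k \<Rightarrow> real"
    let ?s = "\<Sum>k\<in>K. \<bar>J k\<bar>"
    have "\<bar>f t J * g t J\<bar> \<le> (C * exp (D * ?s)) * (C' * exp (D' * ?s))"
      unfolding abs_mult using * by (intro mult_mono) auto
    then show "\<bar>f t J * g t J\<bar> \<le> (C * C') * exp ((D + D') * ?s)"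
      by (simp add: exp_add distrib_right mult_ac)
  qed
qed

lemma exp_bounded_diff:
  "exp_bounded K f \<Longrightarrow> exp_bounded K g \<Longrightarrow> exp_bounded K (\<lambda>t J. f t J - g t J)"
  using exp_bounded_add[of K f "\<lambda>t J. -1 * g t J"] exp_bounded_mult[OF exp_bounded_const, of K g "-1"]
  by simp

lemma exp_bounded_sum:
  assumes "finite I" "\<And>i. i \<in> I \<Longrightarrow> exp_bounded K (\<lambda>t J. f i t J)"
  shows "exp_bounded K (\<lambda>t J. \<Sum>i\<in>I. f i t J)"
  using assms by (induction I rule: finite_induct) (auto intro: exp_bounded_add exp_bounded_const)

text \<open>Transfers bounds from centred to planted couplings: by the triangle inequality the shift
  only costs the constant factor \<open>exp (D * (\<Sum>k\<in>K. \<bar>c k\<bar>))\<close>.\<close>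

lemma exp_bounded_shift:
  fixes K :: "'k set" and c :: "'k \<Rightarrow> real"
  assumes "exp_bounded K f"
  shows "exp_bounded K (\<lambda>t J. f t (\<lambda>k. J k + c k))"
  using assms
proof (rule exp_boundedE)
  fix C D assume *: "0 \<le> C" "0 \<le> D" "\<And>t J. \<bar>f t J\<bar> \<le> C * exp (D * (\<Sum>k\<in>K. \<bar>J k\<bar>))"
  show ?thesis
  proof (rule exp_boundedI)
    fix t and J :: "'k \<Rightarrow> real"
    have "(\<Sum>k\<in>K. \<bar>J k + c k\<bar>) \<le> (\<Sum>k\<in>K. \<bar>c k\<bar>) + (\<Sum>k\<in>K. \<bar>J k\<bar>)"
      unfolding sum.distrib[symmetric] by (intro sum_mono) linarith
    then have "C * exp (D * (\<Sum>k\<in>K. \<bar>J k + c k\<bar>)) \<le> C * exp (D * ((\<Sum>k\<in>K. \<bar>c k\<bar>) + (\<Sum>k\<in>K. \<bar>J k\<bar>)))"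
      using * by (intro mult_left_mono) (auto intro: mult_left_mono)
    also have "\<dots> = C * exp (D * (\<Sum>k\<in>K. \<bar>c k\<bar>)) * exp (D * (\<Sum>k\<in>K. \<bar>J k\<bar>))"
      by (simp only: distrib_left exp_add mult.assoc)
    finally show "\<bar>f t (\<lambda>k. J k + c k)\<bar> \<le> C * exp (D * (\<Sum>k\<in>K. \<bar>c k\<bar>)) * exp (D * (\<Sum>k\<in>K. \<bar>J k\<bar>))"
      by (rule order_trans[OF *(3)])
  qed
qed

lemma integrable_exp_abs_std_normal_PiM:
  assumes "finite K"
  shows "integrable (std_normal_PiM K) (\<lambda>J. C * exp (D * (\<Sum>k\<in>K. \<bar>J k\<bar>)))"
proof -
  interpret N: product_sigma_finite "\<lambda>_::'a. std_normal_distribution"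
    by (intro product_sigma_finite.intro prob_space_imp_sigma_finite prob_space_std_normal)
  have "integrable (std_normal_PiM K) (\<lambda>J. \<Prod>k\<in>K. exp (D * \<bar>J k\<bar>))"
    by (rule N.product_integrable_prod[OF assms integrable_exp_abs_std_normal])
  then show ?thesis
    using assms by (simp add: exp_sum sum_distrib_left)
qed

lemma integrable_exp_bounded:
  assumes "finite K" "exp_bounded K f" "f t \<in> borel_measurable (std_normal_PiM K)"
  shows "integrable (std_normal_PiM K) (f t)"
  using assms(2)
proof (rule exp_boundedE)
  fix C D assume CD: "0 \<le> C" "\<And>t J. \<bar>f t J\<bar> \<le> C * exp (D * (\<Sum>k\<in>K. \<bar>J k\<bar>))"
  show ?thesis
    by (rule Bochner_Integration.integrable_bound[OF integrable_exp_abs_std_normal_PiM[OF assms(1), of C D] assms(3)])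
      (use CD in auto)
qed

text \<open>Differentiate the shift formula \<open>integral_std_normal_PiM_affine\<close> in the shift at 0.\<close>

lemma std_normal_integration_by_parts:
  fixes F F' :: "('k \<Rightarrow> real) \<Rightarrow> real"
  assumes K: "finite K" "l \<in> K"
    and [measurable]: "F \<in> borel_measurable (std_normal_PiM K)" "F' \<in> borel_measurable (std_normal_PiM K)"
    and deriv: "\<And>J y. ((\<lambda>y. F (J(l := y))) has_real_derivative F' (J(l := y))) (at y)"
    and F: "exp_bounded K (\<lambda>_::unit. F)" and F': "exp_bounded K (\<lambda>_::unit. F')"
  shows "(\<integral>J. J l * F J \<partial>std_normal_PiM K) = (\<integral>J. F' J \<partial>std_normal_PiM K)"
proof -
  let ?M = "std_normal_PiM K"
  let ?sh = "\<lambda>h J. J(l := J l + h) :: 'k \<Rightarrow> real"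
  from F F' obtain C D C' D' where *: "0 \<le> C" "0 \<le> D" "0 \<le> C'" "0 \<le> D'"
    "\<And>J. \<bar>F J\<bar> \<le> C * exp (D * (\<Sum>k\<in>K. \<bar>J k\<bar>))"
    "\<And>J. \<bar>F' J\<bar> \<le> C' * exp (D' * (\<Sum>k\<in>K. \<bar>J k\<bar>))"
    by (metis exp_boundedE)
  have [measurable]: "(\<lambda>J. J l) \<in> borel_measurable ?M"
    using measurable_component_singleton[of l K "\<lambda>_. std_normal_distribution"] K by simp
  have sh_eq: "?sh h J = (\<lambda>k\<in>K. 1 * J k + (if k = l then h else 0))" if "J \<in> space ?M" for h J
    using that K by (auto simp: space_PiM PiE_iff extensional_def fun_eq_iff)
  have [measurable]: "?sh h \<in> ?M \<rightarrow>\<^sub>M ?M" for h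
    by (subst measurable_cong[OF sh_eq]) auto
  have sum_sh: "(\<Sum>k\<in>K. \<bar>?sh h J k\<bar>) \<le> (\<Sum>k\<in>K. \<bar>J k\<bar>) + \<bar>h\<bar>" for h J
    using K by (simp add: sum.remove[of K l] abs_triangle_ineq)
  \<comment> \<open>A shift by less than 1 costs at most the factor \<open>exp D\<close>, which
    gives one dominating function for the whole window around 0.\<close>
  have bd: "C * exp (D * (\<Sum>k\<in>K. \<bar>?sh h J k\<bar>)) \<le> C * exp D * exp (D * (\<Sum>k\<in>K. \<bar>J k\<bar>))"
    if "\<bar>h\<bar> < 1" "0 \<le> C" "0 \<le> D" for h J C D
  proof -
    have "D * (\<Sum>k\<in>K. \<bar>?sh h J k\<bar>) \<le> D * ((\<Sum>k\<in>K. \<bar>J k\<bar>) + 1)"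
      using that sum_sh[of J h] by (intro mult_left_mono) auto
    then have "exp (D * (\<Sum>k\<in>K. \<bar>?sh h J k\<bar>)) \<le> exp (D * ((\<Sum>k\<in>K. \<bar>J k\<bar>) + 1))" by simp
    then have "exp (D * (\<Sum>k\<in>K. \<bar>?sh h J k\<bar>)) \<le> exp D * exp (D * (\<Sum>k\<in>K. \<bar>J k\<bar>))"
      by (simp only: distrib_left exp_add mult_1_right mult.commute)
    from mult_left_mono[OF this that(2)] show ?thesis by (simp only: mult.assoc)
  qed
  have shift_deriv: "((\<lambda>h. \<integral>J. F (?sh h J) \<partial>?M) has_real_derivative (\<integral>J. F' (?sh 0 J) \<partial>?M)) (at 0)"
  proof (rule has_real_derivative_lebesgue_integral[where a = "-1" and b = 1])
    show "integrable ?M (\<lambda>J. C' * exp D' * exp (D' * (\<Sum>k\<in>K. \<bar>J k\<bar>)))"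
      by (rule integrable_exp_abs_std_normal_PiM) fact
    show "integrable ?M (\<lambda>J. F (?sh t J))" if "t \<in> {-1<..<1}" for t
    proof (rule Bochner_Integration.integrable_bound[OF integrable_exp_abs_std_normal_PiM[OF K(1), of "C * exp D" D]])
      have "\<bar>F (?sh t J)\<bar> \<le> C * exp D * exp (D * (\<Sum>k\<in>K. \<bar>J k\<bar>))" for J
        by (rule order_trans[OF *(5)[of "?sh t J"] bd[of t C D J]]) (use *(1,2) that in auto)
      then show "AE J in ?M. norm (F (?sh t J)) \<le> norm (C * exp D * exp (D * (\<Sum>k\<in>K. \<bar>J k\<bar>)))"
        using *(1) by (intro AE_I2) (simp only: real_norm_def abs_mult abs_exp_cancel abs_of_nonneg)
    qed measurable
    show "\<bar>F' (?sh t J)\<bar> \<le> C' * exp D' * exp (D' * (\<Sum>k\<in>K. \<bar>J k\<bar>))" if "t \<in> {-1<..<1}" for t J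
      by (rule order_trans[OF *(6)[of "?sh t J"] bd[of t C' D' J]]) (use *(3,4) that in auto)
    show "((\<lambda>h. F (?sh h J)) has_real_derivative F' (?sh t J)) (at t)" for t J
    proof -
      have "((\<lambda>h. J l + h) has_real_derivative 1) (at t)"
        by (auto intro!: derivative_eq_intros)
      from DERIV_chain2[where g = "\<lambda>h. J l + h" and x = t and s = UNIV, OF deriv[of J "J l + t"] this]
      show ?thesis by simp
    qed
  qed auto
  \<comment> \<open>The same integral with the shift moved from the argument of \<open>F\<close> to
    the density. Its derivative at 0 produces \<open>J l\<close>, and uniqueness of derivatives
    equates it with the integral of \<open>F'\<close>.\<close>
  have sh_int: "(\<integral>J. F (?sh h J) \<partial>?M) = (\<integral>J. F J * exp (h * J l - h\<^sup>2 / 2) \<partial>?M)" for h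
  proof -
    have "(\<integral>J. F (?sh h J) \<partial>?M) = (\<integral>J. F (\<lambda>k\<in>K. 1 * J k + (if k = l then h else 0)) \<partial>?M)"
      by (intro Bochner_Integration.integral_cong refl) (simp only: sh_eq)
    also have "\<dots> = (\<integral>J. F J * exp (\<Sum>k\<in>K. (if k = l then h else 0) * J k - (if k = l then h else 0)\<^sup>2 / 2) \<partial>?M)"
      by (rule integral_std_normal_PiM_affine) (use K in auto)
    also have "\<dots> = (\<integral>J. F J * exp (h * J l - h\<^sup>2 / 2) \<partial>?M)"
      using K by (simp add: sum.remove[of K l])
    finally show ?thesis .
  qed
  have "((\<lambda>h. \<integral>J. F J * exp (h * J l - h\<^sup>2 / 2) \<partial>?M) has_real_derivative
      (\<integral>J. F J * (exp (0 * J l - 0\<^sup>2 / 2) * (J l - 0)) \<partial>?M)) (at 0)"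
  proof (rule has_real_derivative_lebesgue_integral[where a = "-1" and b = 1])
    have Jl: "\<bar>J l\<bar> \<le> (\<Sum>k\<in>K. \<bar>J k\<bar>)" for J :: "'k \<Rightarrow> real"
      using K by (intro member_le_sum) auto
    have e: "exp (h * J l - h\<^sup>2 / 2) \<le> exp (\<Sum>k\<in>K. \<bar>J k\<bar>)" if "\<bar>h\<bar> < 1" for h :: real and J :: "'k \<Rightarrow> real"
    proof -
      have "h * J l \<le> \<bar>h\<bar> * \<bar>J l\<bar>" using abs_ge_self[of "h * J l"] by (simp only: abs_mult)
      also have "\<dots> \<le> 1 * \<bar>J l\<bar>" using that by (intro mult_right_mono) auto
      finally have "h * J l - h\<^sup>2 / 2 \<le> (\<Sum>k\<in>K. \<bar>J k\<bar>)"
        using Jl[of J] zero_le_power2[of h] by linarith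
      then show ?thesis by simp
    qed
    have lin: "\<bar>h - J l\<bar> \<le> exp (\<Sum>k\<in>K. \<bar>J k\<bar>)" if "\<bar>h\<bar> < 1" for h :: real and J :: "'k \<Rightarrow> real"
      using that Jl[of J] exp_ge_add_one_self[of "\<Sum>k\<in>K. \<bar>J k\<bar>"] by linarith
    \<comment> \<open>One extra unit in the exponent pays for the tilt
      \<open>exp (t * J l - t\<^sup>2 / 2)\<close>, the other for the linear factor
      \<open>J l - t\<close>.\<close>
    show "integrable ?M (\<lambda>J. C * exp ((D + 1 + 1) * (\<Sum>k\<in>K. \<bar>J k\<bar>)))"
      by (rule integrable_exp_abs_std_normal_PiM) fact
    show "\<bar>F J * (exp (t * J l - t\<^sup>2 / 2) * (J l - t))\<bar> \<le> C * exp ((D + 1 + 1) * (\<Sum>k\<in>K. \<bar>J k\<bar>))"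
      if "t \<in> {-1<..<1}" for t J
    proof -
      have "\<bar>F J * (exp (t * J l - t\<^sup>2 / 2) * (J l - t))\<bar>
          \<le> (C * exp (D * (\<Sum>k\<in>K. \<bar>J k\<bar>))) * (exp (\<Sum>k\<in>K. \<bar>J k\<bar>) * exp (\<Sum>k\<in>K. \<bar>J k\<bar>))"
        unfolding abs_mult using that *(1) *(5)[of J] e[of t J] lin[of t J] by (intro mult_mono) (auto simp: abs_minus_commute)
      then show ?thesis
        by (simp only: exp_add distrib_right mult.assoc mult_1_left)
    qed
    show "integrable ?M (\<lambda>J. F J * exp (t * J l - t\<^sup>2 / 2))" if "t \<in> {-1<..<1}" for t
    proof (rule Bochner_Integration.integrable_bound[OF integrable_exp_abs_std_normal_PiM[OF K(1), of C "D + 1"]])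
      have "\<bar>F J * exp (t * J l - t\<^sup>2 / 2)\<bar> \<le> C * exp ((D + 1) * (\<Sum>k\<in>K. \<bar>J k\<bar>))" for J
      proof -
        have "\<bar>F J * exp (t * J l - t\<^sup>2 / 2)\<bar> \<le> (C * exp (D * (\<Sum>k\<in>K. \<bar>J k\<bar>))) * exp (\<Sum>k\<in>K. \<bar>J k\<bar>)"
          unfolding abs_mult using that *(1) *(5)[of J] e[of t J] by (intro mult_mono) auto
        then show ?thesis by (simp only: exp_add distrib_right mult.assoc mult_1_left)
      qed
      then show "AE J in ?M. norm (F J * exp (t * J l - t\<^sup>2 / 2)) \<le> norm (C * exp ((D + 1) * (\<Sum>k\<in>K. \<bar>J k\<bar>)))"
        using *(1) by (intro AE_I2) (simp only: real_norm_def abs_mult abs_exp_cancel abs_of_nonneg)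
    qed measurable
    show "((\<lambda>h. F J * exp (h * J l - h\<^sup>2 / 2)) has_real_derivative
        F J * (exp (t * J l - t\<^sup>2 / 2) * (J l - t))) (at t)" for t J
      by (auto intro!: derivative_eq_intros)
  qed auto
  with shift_deriv have "(\<integral>J. F' (?sh 0 J) \<partial>?M) = (\<integral>J. F J * (exp (0 * J l - 0\<^sup>2 / 2) * (J l - 0)) \<partial>?M)"
    unfolding sh_int by (rule DERIV_unique)
  then show ?thesis by (simp add: mult.commute)
qed

section \<open>Heat equation for Gibbs weights\<close>

locale gibbs =
  fixes K :: "'k set" and \<Omega> :: "'s set" and \<sigma> :: "'k \<Rightarrow> 's \<Rightarrow> real"
  assumes finite_K: "finite K" and finite_\<Omega>: "finite \<Omega>" and \<Omega>_ne: "\<Omega> \<noteq> {}"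
    and \<sigma>_sq: "\<And>k S. k \<in> K \<Longrightarrow> S \<in> \<Omega> \<Longrightarrow> \<sigma> k S * \<sigma> k S = 1"
begin

abbreviation M :: "('k \<Rightarrow> real) measure" where
  "M \<equiv> std_normal_PiM K"

text \<open>The likelihood ratio at \<open>J\<close> of independent Gaussians with means \<open>c k * \<sigma> k S\<close>
  against centred ones.\<close>

definition w :: "('k \<Rightarrow> real) \<Rightarrow> ('k \<Rightarrow> real) \<Rightarrow> 's \<Rightarrow> real" where
  "w c J S = exp (\<Sum>k\<in>K. c k * \<sigma> k S * J k - (c k)\<^sup>2 / 2)"

lemma w_pos: "0 < w c J S" by (simp add: w_def)

lemma \<sigma>_abs: "k \<in> K \<Longrightarrow> S \<in> \<Omega> \<Longrightarrow> \<bar>\<sigma> k S\<bar> = 1"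
  using \<sigma>_sq[of k S] by (auto simp: square_eq_1_iff)

lemma measurable_component [measurable]: "k \<in> K \<Longrightarrow> (\<lambda>J. J k) \<in> borel_measurable M"
  using measurable_component_singleton[of k K "\<lambda>_. std_normal_distribution"] by simp

lemma measurable_w [measurable]: "(\<lambda>J. w c J S) \<in> borel_measurable M"
  unfolding w_def by measurable

lemma w_deriv_param:
  assumes "\<And>k. k \<in> K \<Longrightarrow> ((\<lambda>t. c t k) has_real_derivative c' k) (at t)"
  shows "((\<lambda>t. w (c t) J S) has_real_derivative
    (\<Sum>k\<in>K. c' k * (\<sigma> k S * J k - c t k)) * w (c t) J S) (at t)"
proof -
  have "((\<lambda>t. \<Sum>k\<in>K. c t k * \<sigma> k S * J k - (c t k)\<^sup>2 / 2) has_real_derivative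
      (\<Sum>k\<in>K. c' k * (\<sigma> k S * J k - c t k))) (at t)"
    by (intro DERIV_sum) (auto intro!: derivative_eq_intros assms simp: algebra_simps)
  from DERIV_fun_exp[OF this] show ?thesis
    unfolding w_def by (simp only: mult.commute)
qed

lemma w_deriv_component:
  assumes "l \<in> K"
  shows "((\<lambda>y. w c (J(l := y)) S) has_real_derivative
    c l * \<sigma> l S * w c (J(l := y)) S) (at y)"
proof -
  have "((\<lambda>y. \<Sum>k\<in>K. c k * \<sigma> k S * (J(l := y)) k - (c k)\<^sup>2 / 2) has_real_derivative
      (\<Sum>k\<in>K. if k = l then c l * \<sigma> l S else 0)) (at y)"
    by (intro DERIV_sum) (auto intro!: derivative_eq_intros)
  also have "(\<Sum>k\<in>K. if k = l then c l * \<sigma> l S else 0) = c l * \<sigma> l S"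
    using assms finite_K by simp
  finally have "((\<lambda>y. \<Sum>k\<in>K. c k * \<sigma> k S * (J(l := y)) k - (c k)\<^sup>2 / 2) has_real_derivative
      c l * \<sigma> l S) (at y)" .
  from DERIV_fun_exp[OF this] show ?thesis
    unfolding w_def by (simp only: mult.commute)
qed

lemma exp_bounded_exp_linear:
  assumes a: "\<And>t k. k \<in> K \<Longrightarrow> \<bar>a t k\<bar> \<le> B" and b: "\<And>t. b t \<le> B'"
  shows "exp_bounded K (\<lambda>t J. exp ((\<Sum>k\<in>K. a t k * J k) + b t))"
proof (rule exp_boundedI)
  fix t and J :: "'k \<Rightarrow> real"
  have "(\<Sum>k\<in>K. a t k * J k) \<le> (\<Sum>k\<in>K. B * \<bar>J k\<bar>)"
  proof (rule sum_mono)
    fix k assume "k \<in> K"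
    have "a t k * J k \<le> \<bar>a t k\<bar> * \<bar>J k\<bar>" using abs_ge_self[of "a t k * J k"] by (simp only: abs_mult)
    also have "\<dots> \<le> B * \<bar>J k\<bar>" by (intro mult_right_mono a \<open>k \<in> K\<close>) auto
    finally show "a t k * J k \<le> B * \<bar>J k\<bar>" .
  qed
  then have "(\<Sum>k\<in>K. a t k * J k) + b t \<le> B * (\<Sum>k\<in>K. \<bar>J k\<bar>) + B'"
    using b[of t] by (simp add: sum_distrib_left)
  then show "\<bar>exp ((\<Sum>k\<in>K. a t k * J k) + b t)\<bar> \<le> exp B' * exp (B * (\<Sum>k\<in>K. \<bar>J k\<bar>))"
    by (simp add: exp_add[symmetric] add.commute)
qed

text \<open>The spins have absolute value 1, so bounded couplings give an exponent that is linear in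
  \<open>J\<close> with bounded coefficients. The reciprocal is bounded as well because logarithms
  and quotients require control of small weights.\<close>

lemma
  assumes c: "\<And>t k. k \<in> K \<Longrightarrow> \<bar>c t k\<bar> \<le> B" and S: "S \<in> \<Omega>"
  shows exp_bounded_w: "exp_bounded K (\<lambda>t J. w (c t) J S)"
    and exp_bounded_inverse_w: "exp_bounded K (\<lambda>t J. 1 / w (c t) J S)"
proof -
  have sq: "(\<Sum>k\<in>K. (c t k)\<^sup>2 / 2) \<le> (\<Sum>k\<in>K. B\<^sup>2 / 2)" for t
  proof (intro sum_mono divide_right_mono)
    show "(c t k)\<^sup>2 \<le> B\<^sup>2" if "k \<in> K" for k
      using power_mono[OF c[OF that, of t], of 2] by simp
  qed simp
  have a: "k \<in> K \<Longrightarrow> \<bar>c t k * \<sigma> k S\<bar> \<le> B" for t k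
    using c[of k t] S by (simp add: abs_mult \<sigma>_abs)
  have "exp_bounded K (\<lambda>t J. exp ((\<Sum>k\<in>K. (c t k * \<sigma> k S) * J k) + - (\<Sum>k\<in>K. (c t k)\<^sup>2 / 2)))"
    by (rule exp_bounded_exp_linear[where B = B and B' = 0]) (use a in \<open>auto intro!: sum_nonneg\<close>)
  then show "exp_bounded K (\<lambda>t J. w (c t) J S)"
    by (simp add: w_def sum_subtractf)
  have "exp_bounded K (\<lambda>t J. exp ((\<Sum>k\<in>K. (- (c t k * \<sigma> k S)) * J k) + (\<Sum>k\<in>K. (c t k)\<^sup>2 / 2)))"
    by (rule exp_bounded_exp_linear[where B = B, OF _ sq]) (use a in auto)
  moreover have "exp ((\<Sum>k\<in>K. (- (c t k * \<sigma> k S)) * J k) + (\<Sum>k\<in>K. (c t k)\<^sup>2 / 2)) = 1 / w (c t) J S" for t J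
  proof -
    have "(\<Sum>k\<in>K. (- (c t k * \<sigma> k S)) * J k) + (\<Sum>k\<in>K. (c t k)\<^sup>2 / 2)
        = - (\<Sum>k\<in>K. c t k * \<sigma> k S * J k - (c t k)\<^sup>2 / 2)"
      by (simp add: sum_subtractf sum_negf)
    then show ?thesis by (simp only: w_def exp_minus inverse_eq_divide)
  qed
  ultimately show "exp_bounded K (\<lambda>t J. 1 / w (c t) J S)" by simp
qed

text \<open>\<open>A\<close> and \<open>B\<close> are the gradient and the Hessian of \<open>\<phi>\<close>. Integrating \<open>J l\<close> by parts
  produces, besides the Hessian term, a gradient term that cancels against the derivative of the
  normalisation \<open>- (c k)\<^sup>2 / 2\<close>.\<close>

lemma heat_equation:
  fixes c :: "real \<Rightarrow> 'k \<Rightarrow> real" and \<phi> :: "('s \<Rightarrow> real) \<Rightarrow> real"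
  assumes c_deriv: "\<And>t k. k \<in> K \<Longrightarrow> ((\<lambda>t. c t k) has_real_derivative c' t k) (at t)"
    and c_bound: "\<And>t k. k \<in> K \<Longrightarrow> \<bar>c t k\<bar> \<le> b"
    and c'_bound: "\<And>t k. k \<in> K \<Longrightarrow> \<bar>c' t k\<bar> \<le> b"
    and \<phi>_deriv: "\<And>v v' x. (\<And>S. S \<in> \<Omega> \<Longrightarrow> ((\<lambda>s. v s S) has_real_derivative v' S) (at x)) \<Longrightarrow>
      (\<And>S. S \<in> \<Omega> \<Longrightarrow> 0 < v x S) \<Longrightarrow>
      ((\<lambda>s. \<phi> (v s)) has_real_derivative (\<Sum>S\<in>\<Omega>. A S (v x) * v' S)) (at x)"
    and A_deriv: "\<And>v v' x S. (\<And>T. T \<in> \<Omega> \<Longrightarrow> ((\<lambda>s. v s T) has_real_derivative v' T) (at x)) \<Longrightarrow>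
      (\<And>T. T \<in> \<Omega> \<Longrightarrow> 0 < v x T) \<Longrightarrow> S \<in> \<Omega> \<Longrightarrow>
      ((\<lambda>s. A S (v s)) has_real_derivative (\<Sum>T\<in>\<Omega>. B S T (v x) * v' T)) (at x)"
    and [measurable]: "\<And>a. (\<lambda>J. \<phi> (w a J)) \<in> borel_measurable M"
      "\<And>a S. S \<in> \<Omega> \<Longrightarrow> (\<lambda>J. A S (w a J)) \<in> borel_measurable M"
      "\<And>a S T. S \<in> \<Omega> \<Longrightarrow> T \<in> \<Omega> \<Longrightarrow> (\<lambda>J. B S T (w a J)) \<in> borel_measurable M"
    and \<phi>_bd: "exp_bounded K (\<lambda>t J. \<phi> (w (c t) J))"
    and A_bd: "\<And>S. S \<in> \<Omega> \<Longrightarrow> exp_bounded K (\<lambda>t J. A S (w (c t) J))"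
    and B_bd: "\<And>S T. S \<in> \<Omega> \<Longrightarrow> T \<in> \<Omega> \<Longrightarrow> exp_bounded K (\<lambda>t J. B S T (w (c t) J))"
  shows "((\<lambda>t. \<integral>J. \<phi> (w (c t) J) \<partial>M) has_real_derivative
    (\<Sum>l\<in>K. c t l * c' t l * (\<integral>J. (\<Sum>S\<in>\<Omega>. \<Sum>T\<in>\<Omega>.
      B S T (w (c t) J) * \<sigma> l S * \<sigma> l T * w (c t) J S * w (c t) J T) \<partial>M))) (at t)"
proof -
  note bd = exp_bounded_sum[OF finite_\<Omega>] exp_bounded_sum[OF finite_K] exp_bounded_mult exp_bounded_add
    exp_bounded_diff exp_bounded_const exp_bounded_component[OF finite_K] exp_bounded_w[OF c_bound] A_bd B_bd
  have c_bd: "k \<in> K \<Longrightarrow> exp_bounded K (\<lambda>t J. c t k)" and c'_bd: "k \<in> K \<Longrightarrow> exp_bounded K (\<lambda>t J. c' t k)" for k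
    by (rule exp_bounded_bounded[where B = b], use c_bound c'_bound in blast)+
  let ?W = "\<lambda>t. w (c t)"
  \<comment> \<open>The time derivative of the integrand. Its exponential bound is uniform in time,
    so it supplies the dominating function.\<close>
  let ?D = "\<lambda>t J. \<Sum>S\<in>\<Omega>. A S (?W t J) * ((\<Sum>k\<in>K. c' t k * (\<sigma> k S * J k - c t k)) * ?W t J S)"
  have D_bd: "exp_bounded K ?D"
    by (intro bd c_bd c'_bd; assumption)
  have D_meas [measurable]: "?D t \<in> borel_measurable M" for t by measurable
  have "((\<lambda>t. \<integral>J. \<phi> (?W t J) \<partial>M) has_real_derivative (\<integral>J. ?D t J \<partial>M)) (at t)"
  proof -
    from D_bd obtain C D where CD: "\<And>t J. \<bar>?D t J\<bar> \<le> C * exp (D * (\<Sum>k\<in>K. \<bar>J k\<bar>))"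
      by (rule exp_boundedE) blast
    show ?thesis
      by (rule has_real_derivative_lebesgue_integral[where a = "t - 1" and b = "t + 1",
            OF _ _ _ CD integrable_exp_abs_std_normal_PiM[OF finite_K]])
        (auto intro!: integrable_exp_bounded[OF finite_K \<phi>_bd] \<phi>_deriv w_deriv_param c_deriv w_pos)
  qed
  \<comment> \<open>\<open>?D\<close> splits into the parts \<open>?F l\<close> multiplied by
    \<open>J l\<close> and the part \<open>?U\<close> from the normalisation. \<open>?V l\<close> is
    the Hessian applied twice to the direction in which the weights move when \<open>J l\<close>
    varies, up to the factor \<open>c t l\<close>.\<close>
  let ?F = "\<lambda>l J. \<Sum>S\<in>\<Omega>. A S (?W t J) * (\<sigma> l S * ?W t J S)"
  let ?U = "\<lambda>J. \<Sum>S\<in>\<Omega>. A S (?W t J) * ?W t J S"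
  let ?V = "\<lambda>l J. \<Sum>S\<in>\<Omega>. \<Sum>T\<in>\<Omega>. B S T (?W t J) * \<sigma> l S * \<sigma> l T * ?W t J S * ?W t J T"
  have bd_t: "exp_bounded K (\<lambda>_::unit. f t)" if "exp_bounded K f" for f :: "real \<Rightarrow> ('k \<Rightarrow> real) \<Rightarrow> real"
    by (rule exp_bounded_reindex[OF that])
  have F_bd: "exp_bounded K (\<lambda>_::unit. ?F l)" if "l \<in> K" for l
    by (rule bd_t, intro bd that)
  have U_bd: "exp_bounded K (\<lambda>_::unit. ?U)"
    by (rule bd_t, intro bd)
  have V_bd: "exp_bounded K (\<lambda>_::unit. ?V l)" if "l \<in> K" for l
    by (rule bd_t, intro bd that)
  have J_bd: "exp_bounded K (\<lambda>_::unit. \<lambda>J. J l * ?F l J)" if "l \<in> K" for l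
    by (rule bd_t, intro bd that)
  have int [simp]: "integrable M (?F l)" "integrable M ?U" "integrable M (?V l)" "integrable M (\<lambda>J. J l * ?F l J)"
    if "l \<in> K" for l
    using integrable_exp_bounded[OF finite_K F_bd[OF that]] integrable_exp_bounded[OF finite_K U_bd]
      integrable_exp_bounded[OF finite_K V_bd[OF that]] integrable_exp_bounded[OF finite_K J_bd[OF that]] that
    by auto
  have ibp: "(\<integral>J. J l * ?F l J \<partial>M) = c t l * ((\<integral>J. ?V l J \<partial>M) + (\<integral>J. ?U J \<partial>M))" if l: "l \<in> K" for l
  proof -
    have "(\<integral>J. J l * ?F l J \<partial>M) = (\<integral>J. c t l * (?V l J + ?U J) \<partial>M)"
    proof (rule std_normal_integration_by_parts[OF finite_K l])
      fix J y
      let ?v = "\<lambda>y. ?W t (J(l := y))"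
      \<comment> \<open>The gradient \<open>A\<close> is differentiated along the curve of weights
        traced by the single coordinate \<open>J l\<close>. The terms in which the weight itself is
        differentiated contain \<open>\<sigma> l S\<close> twice, and its square is 1, so they give
        \<open>?U\<close>, independent of \<open>l\<close>.\<close>
      have "((\<lambda>y. ?F l (J(l := y))) has_real_derivative (\<Sum>S\<in>\<Omega>.
          A S (?v y) * (\<sigma> l S * (c t l * \<sigma> l S * ?v y S)) +
          (\<Sum>T\<in>\<Omega>. B S T (?v y) * (c t l * \<sigma> l T * ?v y T)) * (\<sigma> l S * ?v y S))) (at y)"
        by (intro DERIV_sum DERIV_mult' A_deriv w_deriv_component DERIV_cmult l w_pos)
      also have "(\<Sum>S\<in>\<Omega>. A S (?v y) * (\<sigma> l S * (c t l * \<sigma> l S * ?v y S)) +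
          (\<Sum>T\<in>\<Omega>. B S T (?v y) * (c t l * \<sigma> l T * ?v y T)) * (\<sigma> l S * ?v y S))
        = c t l * (?V l (J(l := y)) + ?U (J(l := y)))" (is "?lhs = ?rhs")
      proof -
        have "?lhs = (\<Sum>S\<in>\<Omega>. c t l * (A S (?v y) * ?v y S) +
          c t l * (\<Sum>T\<in>\<Omega>. B S T (?v y) * \<sigma> l S * \<sigma> l T * ?v y S * ?v y T))"
        proof (intro sum.cong refl arg_cong2[where f = "(+)"])
          fix S assume S: "S \<in> \<Omega>"
          have "A S (?v y) * (\<sigma> l S * (c t l * \<sigma> l S * ?v y S))
            = c t l * (A S (?v y) * ?v y S) * (\<sigma> l S * \<sigma> l S)" by (simp only: mult_ac)
          then show "A S (?v y) * (\<sigma> l S * (c t l * \<sigma> l S * ?v y S)) = c t l * (A S (?v y) * ?v y S)"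
            using \<sigma>_sq[OF l S] by simp
          show "(\<Sum>T\<in>\<Omega>. B S T (?v y) * (c t l * \<sigma> l T * ?v y T)) * (\<sigma> l S * ?v y S)
            = c t l * (\<Sum>T\<in>\<Omega>. B S T (?v y) * \<sigma> l S * \<sigma> l T * ?v y S * ?v y T)"
            by (simp add: sum_distrib_left sum_distrib_right mult_ac)
        qed
        then show ?thesis
          by (simp only: sum.distrib sum_distrib_left distrib_left add.commute)
      qed
      finally show "((\<lambda>y. ?F l (J(l := y))) has_real_derivative c t l * (?V l (J(l := y)) + ?U (J(l := y)))) (at y)" .
      show "exp_bounded K (\<lambda>_::unit. \<lambda>J. c t l * (?V l J + ?U J))"
        by (intro exp_bounded_mult exp_bounded_add exp_bounded_const V_bd U_bd l)
    qed (use F_bd l in auto)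
    then show ?thesis using l by (simp add: Bochner_Integration.integral_add)
  qed
  have "(\<integral>J. ?D t J \<partial>M) = (\<integral>J. (\<Sum>l\<in>K. c' t l * (J l * ?F l J - c t l * ?U J)) \<partial>M)"
  proof (intro Bochner_Integration.integral_cong refl)
    fix J
    have "?D t J = (\<Sum>S\<in>\<Omega>. \<Sum>l\<in>K. c' t l * (J l * (A S (?W t J) * (\<sigma> l S * ?W t J S)) - c t l * (A S (?W t J) * ?W t J S)))"
      by (simp add: sum_distrib_left sum_distrib_right algebra_simps)
    also have "\<dots> = (\<Sum>l\<in>K. c' t l * (J l * ?F l J - c t l * ?U J))"
      by (subst sum.swap) (simp only: sum_distrib_left sum_subtractf[symmetric])
    finally show "?D t J = (\<Sum>l\<in>K. c' t l * (J l * ?F l J - c t l * ?U J))" .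
  qed
  also have "\<dots> = (\<Sum>l\<in>K. \<integral>J. c' t l * (J l * ?F l J - c t l * ?U J) \<partial>M)"
    by (rule Bochner_Integration.integral_sum) auto
  also have "\<dots> = (\<Sum>l\<in>K. c' t l * ((\<integral>J. J l * ?F l J \<partial>M) - c t l * (\<integral>J. ?U J \<partial>M)))"
    by (intro sum.cong refl) (simp add: Bochner_Integration.integral_diff)
  also have "\<dots> = (\<Sum>l\<in>K. c t l * c' t l * (\<integral>J. ?V l J \<partial>M))"
    by (intro sum.cong refl, subst ibp) (simp_all add: algebra_simps)
  finally show ?thesis
    using \<open>((\<lambda>t. \<integral>J. \<phi> (?W t J) \<partial>M) has_real_derivative (\<integral>J. ?D t J \<partial>M)) (at t)\<close> by simp
qed

end

section \<open>Entropy along an interpolation\<close>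

context gibbs
begin

definition Z :: "('s \<Rightarrow> real) \<Rightarrow> real" where
  "Z v = (\<Sum>S\<in>\<Omega>. v S)"

definition mean :: "'k \<Rightarrow> ('s \<Rightarrow> real) \<Rightarrow> real" where
  "mean k v = (\<Sum>S\<in>\<Omega>. \<sigma> k S * v S) / Z v"

lemma Z_pos: "(\<And>S. S \<in> \<Omega> \<Longrightarrow> 0 < v S) \<Longrightarrow> 0 < Z v"
  unfolding Z_def using finite_\<Omega> \<Omega>_ne by (intro sum_pos) auto

lemma Z_w_pos: "0 < Z (w c J)"
  by (rule Z_pos) (rule w_pos)

lemma mean_mult_Z: "0 < Z v \<Longrightarrow> mean k v * Z v = (\<Sum>S\<in>\<Omega>. \<sigma> k S * v S)"
  by (simp add: mean_def)

lemma mean_abs_le: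
  assumes k: "k \<in> K" and v: "\<And>S. S \<in> \<Omega> \<Longrightarrow> 0 < v S"
  shows "\<bar>mean k v\<bar> \<le> 1"
proof -
  have "\<bar>\<Sum>S\<in>\<Omega>. \<sigma> k S * v S\<bar> \<le> (\<Sum>S\<in>\<Omega>. \<bar>\<sigma> k S * v S\<bar>)" by (rule sum_abs)
  also have "\<dots> = Z v"
    unfolding Z_def by (intro sum.cong refl) (simp add: abs_mult \<sigma>_abs[OF k] v less_imp_le)
  finally show ?thesis using Z_pos[of v, OF v] by (simp add: mean_def)
qed

lemma measurable_Z_w [measurable]: "(\<lambda>J. Z (w c J)) \<in> borel_measurable M"
  unfolding Z_def by measurable

lemma measurable_mean_w [measurable]: "(\<lambda>J. mean k (w c J)) \<in> borel_measurable M"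
  unfolding mean_def by measurable

lemma Z_deriv:
  assumes "\<And>S. S \<in> \<Omega> \<Longrightarrow> ((\<lambda>s. v s S) has_real_derivative v' S) (at x)"
  shows "((\<lambda>s. Z (v s)) has_real_derivative (\<Sum>S\<in>\<Omega>. v' S)) (at x)"
  unfolding Z_def by (intro DERIV_sum assms)

text \<open>The quotient rule, arranged so that the spin appears centred; this centring is what
  turns the second derivatives into covariances.\<close>

lemma mean_deriv:
  assumes v': "\<And>S. S \<in> \<Omega> \<Longrightarrow> ((\<lambda>s. v s S) has_real_derivative v' S) (at x)"
    and v: "\<And>S. S \<in> \<Omega> \<Longrightarrow> 0 < v x S"
  shows "((\<lambda>s. mean k (v s)) has_real_derivative
    (\<Sum>T\<in>\<Omega>. (\<sigma> k T - mean k (v x)) / Z (v x) * v' T)) (at x)"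
proof -
  have Z: "0 < Z (v x)" by (rule Z_pos) (rule v)
  have "((\<lambda>s. mean k (v s)) has_real_derivative
      ((\<Sum>S\<in>\<Omega>. \<sigma> k S * v' S) * Z (v x) - (\<Sum>S\<in>\<Omega>. \<sigma> k S * v x S) * (\<Sum>S\<in>\<Omega>. v' S)) / (Z (v x) * Z (v x))) (at x)"
    unfolding mean_def using Z
    by (intro DERIV_divide DERIV_sum DERIV_cmult Z_deriv v') auto
  also have "((\<Sum>S\<in>\<Omega>. \<sigma> k S * v' S) * Z (v x) - (\<Sum>S\<in>\<Omega>. \<sigma> k S * v x S) * (\<Sum>S\<in>\<Omega>. v' S)) / (Z (v x) * Z (v x))
      = ((\<Sum>S\<in>\<Omega>. \<sigma> k S * v' S) - mean k (v x) * (\<Sum>S\<in>\<Omega>. v' S)) / Z (v x)"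
    using Z by (simp add: mean_mult_Z[OF Z, symmetric] field_simps)
  also have "\<dots> = (\<Sum>T\<in>\<Omega>. (\<sigma> k T - mean k (v x)) / Z (v x) * v' T)"
    by (simp add: sum_divide_distrib sum_distrib_left sum_subtractf[symmetric] left_diff_distrib)
  finally show ?thesis .
qed

context
  fixes c :: "'p \<Rightarrow> 'k \<Rightarrow> real" and b :: real
  assumes c: "\<And>t k. k \<in> K \<Longrightarrow> \<bar>c t k\<bar> \<le> b"
begin

lemma exp_bounded_Z: "exp_bounded K (\<lambda>t J. Z (w (c t) J))"
  unfolding Z_def by (intro exp_bounded_sum[OF finite_\<Omega>] exp_bounded_w[OF c])

text \<open>\<open>Z\<close> is at least the weight of any one configuration, whose reciprocal is
  already controlled.\<close>

lemma exp_bounded_inverse_Z: "exp_bounded K (\<lambda>t J. 1 / Z (w (c t) J))"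
proof -
  obtain S where S: "S \<in> \<Omega>" using \<Omega>_ne by blast
  show ?thesis
  proof (rule exp_bounded_mono[OF exp_bounded_inverse_w[OF c S]])
    fix t J
    have "w (c t) J S \<le> Z (w (c t) J)"
      unfolding Z_def using S finite_\<Omega> by (intro member_le_sum) (auto intro: less_imp_le w_pos)
    then show "\<bar>1 / Z (w (c t) J)\<bar> \<le> \<bar>1 / w (c t) J S\<bar>"
      using w_pos[of "c t" J S] Z_w_pos[of "c t" J] by (simp add: frac_le)
  qed
qed

text \<open>The logarithm is large both near 0 and near infinity; \<open>ln z \<le> z\<close> and
  \<open>- ln z \<le> 1 / z\<close> handle the two ends.\<close>

lemma exp_bounded_ln_Z: "exp_bounded K (\<lambda>t J. ln (Z (w (c t) J)))"
proof (rule exp_bounded_mono[OF exp_bounded_add[OF exp_bounded_Z exp_bounded_inverse_Z]])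
  fix t J
  let ?z = "Z (w (c t) J)"
  have z: "0 < ?z" by (rule Z_w_pos)
  have "ln ?z \<le> ?z" using ln_le_minus_one[OF z] by simp
  moreover have "- ln ?z \<le> 1 / ?z"
    using ln_le_minus_one[of "1 / ?z"] z by (simp add: ln_div)
  ultimately show "\<bar>ln ?z\<bar> \<le> \<bar>?z + 1 / ?z\<bar>" using z by (simp add: abs_le_iff add_pos_pos) (smt (verit) z divide_pos_pos)
qed

lemma exp_bounded_mean: "k \<in> K \<Longrightarrow> exp_bounded K (\<lambda>t J. mean k (w (c t) J))"
  by (rule exp_bounded_bounded[where B = 1]) (auto intro: mean_abs_le w_pos)

end

text \<open>The Gibbs covariance without its normalisation: for positive weights it is
  \<open>Z v\<close> times the covariance under the normalised weights.\<close>

definition cov :: "'k \<Rightarrow> 'k \<Rightarrow> ('s \<Rightarrow> real) \<Rightarrow> real" where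
  "cov k l v = (\<Sum>S\<in>\<Omega>. (\<sigma> k S - mean k v) * (\<sigma> l S - mean l v) * v S)"

text \<open>Centring one factor suffices, because a centred spin sums to 0 against the weights. This
  is the shape in which the Hessian below delivers the covariance.\<close>

lemma cov_alt:
  assumes "0 < Z v"
  shows "cov k l v = (\<Sum>S\<in>\<Omega>. (\<sigma> k S - mean k v) * \<sigma> l S * v S)"
proof -
  have "(\<Sum>S\<in>\<Omega>. (\<sigma> k S - mean k v) * v S) = 0"
    using mean_mult_Z[OF assms, of k]
    by (simp add: left_diff_distrib sum_subtractf sum_distrib_left[symmetric] Z_def[symmetric])
  then have "(\<Sum>S\<in>\<Omega>. mean l v * ((\<sigma> k S - mean k v) * v S)) = 0"
    by (simp only: sum_distrib_left[symmetric] mult_zero_right)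
  then show ?thesis
    by (simp add: cov_def right_diff_distrib left_diff_distrib sum_subtractf mult_ac)
qed

lemma measurable_cov [measurable]: "(\<lambda>J. cov k l (w a J)) \<in> borel_measurable M"
  unfolding cov_def by measurable

text \<open>The Hadamard square of the covariance matrix is positive semidefinite: with two replicas
  it is itself a covariance matrix.\<close>

lemma cov_square_psd:
  fixes d :: "'k \<Rightarrow> real"
  assumes v: "\<And>S. S \<in> \<Omega> \<Longrightarrow> 0 \<le> v S"
  shows "0 \<le> (\<Sum>k\<in>K. \<Sum>l\<in>K. d k * d l * (cov k l v)\<^sup>2)"
proof -
  let ?a = "\<lambda>k S. \<sigma> k S - mean k v"
  have "(\<Sum>k\<in>K. \<Sum>l\<in>K. d k * d l * (cov k l v)\<^sup>2)
      = (\<Sum>k\<in>K. \<Sum>l\<in>K. \<Sum>S\<in>\<Omega>. \<Sum>T\<in>\<Omega>. v S * v T * (d k * ?a k S * ?a k T) * (d l * ?a l S * ?a l T))"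
  proof (intro sum.cong refl)
    fix k l
    have "(cov k l v)\<^sup>2 = (\<Sum>S\<in>\<Omega>. \<Sum>T\<in>\<Omega>. (?a k S * ?a l S * v S) * (?a k T * ?a l T * v T))"
      by (simp only: cov_def power2_eq_square sum_product)
    then show "d k * d l * (cov k l v)\<^sup>2
        = (\<Sum>S\<in>\<Omega>. \<Sum>T\<in>\<Omega>. v S * v T * (d k * ?a k S * ?a k T) * (d l * ?a l S * ?a l T))"
      by (simp add: sum_distrib_left mult_ac)
  qed
  also have "\<dots> = (\<Sum>k\<in>K. \<Sum>S\<in>\<Omega>. \<Sum>T\<in>\<Omega>. \<Sum>l\<in>K. v S * v T * (d k * ?a k S * ?a k T) * (d l * ?a l S * ?a l T))"
    by (subst sum.swap, subst (2) sum.swap) (rule refl)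
  also have "\<dots> = (\<Sum>S\<in>\<Omega>. \<Sum>T\<in>\<Omega>. \<Sum>k\<in>K. \<Sum>l\<in>K. v S * v T * (d k * ?a k S * ?a k T) * (d l * ?a l S * ?a l T))"
    by (subst sum.swap, subst (2) sum.swap) (rule refl)
  also have "\<dots> = (\<Sum>S\<in>\<Omega>. \<Sum>T\<in>\<Omega>. v S * v T * (\<Sum>k\<in>K. d k * ?a k S * ?a k T)\<^sup>2)"
    by (intro sum.cong refl) (simp only: power2_eq_square sum_product, simp add: sum_distrib_left mult_ac)
  also have "\<dots> \<ge> 0" by (intro sum_nonneg mult_nonneg_nonneg v zero_le_power2)
  finally show ?thesis .
qed

section \<open>Derivatives along a path of couplings and convexity\<close>

context
  fixes c c' :: "real \<Rightarrow> 'k \<Rightarrow> real" and b :: real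
  assumes c_deriv: "\<And>t k. k \<in> K \<Longrightarrow> ((\<lambda>t. c t k) has_real_derivative c' t k) (at t)"
    and c_bound: "\<And>t k. k \<in> K \<Longrightarrow> \<bar>c t k\<bar> \<le> b"
    and c'_bound: "\<And>t k. k \<in> K \<Longrightarrow> \<bar>c' t k\<bar> \<le> b"
begin

text \<open>The Hessian of \<open>Z ln Z\<close> in the weights has the same entry
  \<open>1 / Z\<close> for every pair of configurations, so the double sum factors into the square
  of one spin sum.\<close>

lemma entropy_deriv:
  "((\<lambda>t. \<integral>J. Z (w (c t) J) * ln (Z (w (c t) J)) \<partial>M) has_real_derivative
    (\<Sum>l\<in>K. c t l * c' t l * (\<integral>J. (mean l (w (c t) J))\<^sup>2 * Z (w (c t) J) \<partial>M))) (at t)"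
proof -
  have "((\<lambda>t. \<integral>J. Z (w (c t) J) * ln (Z (w (c t) J)) \<partial>M) has_real_derivative
    (\<Sum>l\<in>K. c t l * c' t l * (\<integral>J. (\<Sum>S\<in>\<Omega>. \<Sum>T\<in>\<Omega>.
      1 / Z (w (c t) J) * \<sigma> l S * \<sigma> l T * w (c t) J S * w (c t) J T) \<partial>M))) (at t)"
  proof (rule heat_equation[where \<phi> = "\<lambda>v. Z v * ln (Z v)" and A = "\<lambda>S v. ln (Z v) + 1"
        and B = "\<lambda>S T v. 1 / Z v", OF c_deriv c_bound c'_bound])
    fix v :: "real \<Rightarrow> 's \<Rightarrow> real" and v' x
    assume v': "\<And>S. S \<in> \<Omega> \<Longrightarrow> ((\<lambda>s. v s S) has_real_derivative v' S) (at x)"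
      and v: "\<And>S. S \<in> \<Omega> \<Longrightarrow> 0 < v x S"
    have Z: "0 < Z (v x)" by (rule Z_pos) (rule v)
    have ln: "((\<lambda>s. ln (Z (v s))) has_real_derivative (\<Sum>S\<in>\<Omega>. 1 / Z (v x) * v' S)) (at x)"
      using DERIV_ln_divide[OF Z] DERIV_chain2[of ln "1 / Z (v x)" "\<lambda>s. Z (v s)" x _ UNIV] Z_deriv[of v v' x, OF v']
      by (simp add: sum_divide_distrib[symmetric])
    show "((\<lambda>s. Z (v s) * ln (Z (v s))) has_real_derivative (\<Sum>S\<in>\<Omega>. (ln (Z (v x)) + 1) * v' S)) (at x)"
      using DERIV_mult[OF Z_deriv[of v v' x, OF v'] ln] Z
      unfolding sum_distrib_left[symmetric] by (simp add: algebra_simps)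
    show "((\<lambda>s. ln (Z (v s)) + 1) has_real_derivative (\<Sum>S\<in>\<Omega>. 1 / Z (v x) * v' S)) (at x)" for S :: 's
      using DERIV_add[OF ln DERIV_const[of 1]] by simp
  qed (auto intro!: exp_bounded_mult exp_bounded_add exp_bounded_const
      exp_bounded_Z[OF c_bound] exp_bounded_ln_Z[OF c_bound] exp_bounded_inverse_Z[OF c_bound])
  moreover have "(\<Sum>S\<in>\<Omega>. \<Sum>T\<in>\<Omega>. 1 / Z v * \<sigma> l S * \<sigma> l T * v S * v T) = (mean l v)\<^sup>2 * Z v"
    if "0 < Z v" for l and v :: "'s \<Rightarrow> real"
  proof -
    have "(\<Sum>S\<in>\<Omega>. \<Sum>T\<in>\<Omega>. 1 / Z v * \<sigma> l S * \<sigma> l T * v S * v T) = (mean l v * Z v) * (mean l v * Z v) / Z v"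
      unfolding mean_mult_Z[OF that] sum_product
      by (simp add: sum_divide_distrib mult_ac)
    then show ?thesis using that by (simp add: power2_eq_square)
  qed
  ultimately show ?thesis by (simp only: Z_w_pos)
qed

text \<open>The Hessian \<open>?B\<close> of \<open>(mean k v)\<^sup>2 * Z v\<close> has rank one, a
  product of two centred spins over \<open>Z\<close>. Applying it to the spins
  \<open>\<sigma> l\<close> on both sides therefore gives a perfect square, that of the
  covariance.\<close>

lemma sq_mean_deriv:
  assumes k: "k \<in> K"
  shows "((\<lambda>t. \<integral>J. (mean k (w (c t) J))\<^sup>2 * Z (w (c t) J) \<partial>M) has_real_derivative
    (\<Sum>l\<in>K. c t l * c' t l * (\<integral>J. 2 / Z (w (c t) J) * (cov k l (w (c t) J))\<^sup>2 \<partial>M))) (at t)"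
proof -
  let ?B = "\<lambda>S T v. 2 * (\<sigma> k S - mean k v) * ((\<sigma> k T - mean k v) / Z v)"
  have "((\<lambda>t. \<integral>J. (mean k (w (c t) J))\<^sup>2 * Z (w (c t) J) \<partial>M) has_real_derivative
    (\<Sum>l\<in>K. c t l * c' t l * (\<integral>J. (\<Sum>S\<in>\<Omega>. \<Sum>T\<in>\<Omega>.
      ?B S T (w (c t) J) * \<sigma> l S * \<sigma> l T * w (c t) J S * w (c t) J T) \<partial>M))) (at t)"
  proof (rule heat_equation[where \<phi> = "\<lambda>v. (mean k v)\<^sup>2 * Z v"
        and A = "\<lambda>S v. 2 * \<sigma> k S * mean k v - (mean k v)\<^sup>2"
        and B = ?B, OF c_deriv c_bound c'_bound])
    fix v :: "real \<Rightarrow> 's \<Rightarrow> real" and v' x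
    assume v': "\<And>S. S \<in> \<Omega> \<Longrightarrow> ((\<lambda>s. v s S) has_real_derivative v' S) (at x)"
      and v: "\<And>S. S \<in> \<Omega> \<Longrightarrow> 0 < v x S"
    have Z: "0 < Z (v x)" by (rule Z_pos) (rule v)
    note m' = mean_deriv[of v v' x k, OF v' v] and Z' = Z_deriv[of v v' x, OF v']
    let ?m = "mean k (v x)" and ?m' = "\<Sum>T\<in>\<Omega>. (\<sigma> k T - mean k (v x)) / Z (v x) * v' T"
    have "((\<lambda>s. (mean k (v s))\<^sup>2 * Z (v s)) has_real_derivative
        (2 * ?m * ?m') * Z (v x) + ?m\<^sup>2 * (\<Sum>S\<in>\<Omega>. v' S)) (at x)"
      using DERIV_mult[OF DERIV_power[OF m', of 2] Z'] by (simp add: mult_ac)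
    also have "(2 * ?m * ?m') * Z (v x) + ?m\<^sup>2 * (\<Sum>S\<in>\<Omega>. v' S)
        = (\<Sum>S\<in>\<Omega>. (2 * \<sigma> k S * ?m - ?m\<^sup>2) * v' S)"
    proof -
      have "(2 * ?m * ?m') * Z (v x) = (\<Sum>S\<in>\<Omega>. 2 * ?m * (\<sigma> k S - ?m) * v' S)"
        using Z by (simp add: sum_distrib_left sum_distrib_right mult_ac)
      moreover have "?m\<^sup>2 * (\<Sum>S\<in>\<Omega>. v' S) = (\<Sum>S\<in>\<Omega>. ?m\<^sup>2 * v' S)"
        by (rule sum_distrib_left)
      ultimately show ?thesis
        by (simp only: sum.distrib[symmetric]) (intro sum.cong refl, simp add: algebra_simps power2_eq_square)
    qed
    finally show "((\<lambda>s. (mean k (v s))\<^sup>2 * Z (v s)) has_real_derivative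
        (\<Sum>S\<in>\<Omega>. (2 * \<sigma> k S * ?m - ?m\<^sup>2) * v' S)) (at x)" .
    show "((\<lambda>s. 2 * \<sigma> k S * mean k (v s) - (mean k (v s))\<^sup>2) has_real_derivative
        (\<Sum>T\<in>\<Omega>. ?B S T (v x) * v' T)) (at x)" for S
    proof -
      have "((\<lambda>s. 2 * \<sigma> k S * mean k (v s) - (mean k (v s))\<^sup>2) has_real_derivative
          2 * \<sigma> k S * ?m' - 2 * ?m * ?m') (at x)"
        using DERIV_diff[OF DERIV_cmult[OF m', of "2 * \<sigma> k S"] DERIV_power[OF m', of 2]] by (simp add: mult_ac)
      also have "2 * \<sigma> k S * ?m' - 2 * ?m * ?m' = 2 * (\<sigma> k S - ?m) * ?m'" by (simp add: algebra_simps)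
      also have "\<dots> = (\<Sum>T\<in>\<Omega>. ?B S T (v x) * v' T)" by (simp add: sum_distrib_left mult.assoc)
      finally show ?thesis .
    qed
  next
    show "exp_bounded K (\<lambda>t J. ?B S T (w (c t) J))" for S T
    proof -
      have "exp_bounded K (\<lambda>t J. (2 * (\<sigma> k S - mean k (w (c t) J)) * (\<sigma> k T - mean k (w (c t) J)))
          * (1 / Z (w (c t) J)))"
        by (intro exp_bounded_mult exp_bounded_diff exp_bounded_const exp_bounded_mean[OF c_bound]
            exp_bounded_inverse_Z[OF c_bound] k)
      then show ?thesis by simp
    qed
    show "exp_bounded K (\<lambda>t J. (mean k (w (c t) J))\<^sup>2 * Z (w (c t) J))"
      unfolding power2_eq_square
      by (intro exp_bounded_mult exp_bounded_mean[OF c_bound] exp_bounded_Z[OF c_bound] k)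
    show "exp_bounded K (\<lambda>t J. 2 * \<sigma> k S * mean k (w (c t) J) - (mean k (w (c t) J))\<^sup>2)" for S
      unfolding power2_eq_square
      by (intro exp_bounded_diff exp_bounded_mult exp_bounded_const exp_bounded_mean[OF c_bound] k)
  qed auto
  moreover have "(\<Sum>S\<in>\<Omega>. \<Sum>T\<in>\<Omega>. ?B S T v * \<sigma> l S * \<sigma> l T * v S * v T) = 2 / Z v * (cov k l v)\<^sup>2"
    if "0 < Z v" for l and v :: "'s \<Rightarrow> real"
    by (simp only: cov_alt[OF that] power2_eq_square sum_product)
      (simp add: sum_distrib_left mult_ac del: right_diff_distrib_numeral)
  ultimately show ?thesis by (simp only: Z_w_pos)
qed

text \<open>\<open>p\<close> reparametrises time so that the squared couplings move at speed \<open>2 * d k\<close>; in the new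
  time the left-hand side is the tangent at \<open>t0\<close>.\<close>

lemma entropy_gradient_inequality:
  fixes \<kappa> p :: "real \<Rightarrow> real" and d :: "'k \<Rightarrow> real"
  assumes speed: "\<And>t k. k \<in> K \<Longrightarrow> c t k * c' t k = \<kappa> t * d k"
    and p: "\<And>t. (p has_real_derivative \<kappa> t) (at t)"
    and \<kappa>: "\<And>t. t0 \<le> t \<Longrightarrow> t \<le> t1 \<Longrightarrow> 0 \<le> \<kappa> t" and t01: "t0 \<le> t1"
  shows "(p t1 - p t0) * (\<Sum>k\<in>K. d k * (\<integral>J. (mean k (w (c t0) J))\<^sup>2 * Z (w (c t0) J) \<partial>M))
    \<le> (\<integral>J. Z (w (c t1) J) * ln (Z (w (c t1) J)) \<partial>M) - (\<integral>J. Z (w (c t0) J) * ln (Z (w (c t0) J)) \<partial>M)"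
proof -
  define G where "G t = (\<integral>J. Z (w (c t) J) * ln (Z (w (c t) J)) \<partial>M)" for t
  define H where "H t = (\<Sum>k\<in>K. d k * (\<integral>J. (mean k (w (c t) J))\<^sup>2 * Z (w (c t) J) \<partial>M))" for t
  define H' where "H' t = (\<Sum>k\<in>K. d k * (\<Sum>l\<in>K. c t l * c' t l *
    (\<integral>J. 2 / Z (w (c t) J) * (cov k l (w (c t) J))\<^sup>2 \<partial>M)))" for t
  have int: "integrable M (\<lambda>J. 2 / Z (w (c t) J) * (cov k l (w (c t) J))\<^sup>2)" if "k \<in> K" "l \<in> K" for t k l
  proof -
    have "exp_bounded K (\<lambda>t J. (2 * (1 / Z (w (c t) J))) * (cov k l (w (c t) J) * cov k l (w (c t) J)))"
      unfolding cov_def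
      by (intro exp_bounded_mult exp_bounded_diff exp_bounded_sum[OF finite_\<Omega>] exp_bounded_const
          exp_bounded_mean[OF c_bound] exp_bounded_inverse_Z[OF c_bound] exp_bounded_w[OF c_bound] that)
    then have "exp_bounded K (\<lambda>t J. 2 / Z (w (c t) J) * (cov k l (w (c t) J))\<^sup>2)"
      by (simp add: power2_eq_square)
    then show ?thesis by (rule integrable_exp_bounded[OF finite_K]) measurable
  qed
  have G': "(G has_real_derivative \<kappa> t * H t) (at t)" for t
  proof -
    have "(\<Sum>l\<in>K. c t l * c' t l * (\<integral>J. (mean l (w (c t) J))\<^sup>2 * Z (w (c t) J) \<partial>M)) = \<kappa> t * H t"
      by (simp add: H_def sum_distrib_left speed mult.assoc)
    then show ?thesis using entropy_deriv[of t] by (simp add: G_def[abs_def])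
  qed
  have H_deriv: "(H has_real_derivative H' t) (at t)" for t
    unfolding H_def[abs_def] H'_def by (intro DERIV_sum DERIV_cmult sq_mean_deriv)
  \<comment> \<open>The speed condition replaces \<open>c t l * c' t l\<close> by
    \<open>\<kappa> t * d l\<close>, so \<open>H'\<close> becomes \<open>\<kappa> t\<close> times an
    integrated quadratic form in \<open>d\<close>, to which \<open>cov_square_psd\<close> applies
    pointwise.\<close>
  have H'_nonneg: "0 \<le> H' t" if t: "t0 \<le> t" "t \<le> t1" for t
  proof -
    have "H' t = \<kappa> t * (\<Sum>k\<in>K. \<Sum>l\<in>K. d k * d l * (\<integral>J. 2 / Z (w (c t) J) * (cov k l (w (c t) J))\<^sup>2 \<partial>M))"
      by (simp add: H'_def speed sum_distrib_left mult_ac)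
    also have "(\<Sum>k\<in>K. \<Sum>l\<in>K. d k * d l * (\<integral>J. 2 / Z (w (c t) J) * (cov k l (w (c t) J))\<^sup>2 \<partial>M))
        = (\<Sum>k\<in>K. \<integral>J. (\<Sum>l\<in>K. d k * d l * (2 / Z (w (c t) J) * (cov k l (w (c t) J))\<^sup>2)) \<partial>M)"
      by (intro sum.cong refl, subst Bochner_Integration.integral_sum)
        (auto intro!: int integrable_mult_right simp del: times_divide_eq_left)
    also have "\<dots> = (\<integral>J. (\<Sum>k\<in>K. \<Sum>l\<in>K. d k * d l * (2 / Z (w (c t) J) * (cov k l (w (c t) J))\<^sup>2)) \<partial>M)"
      by (subst Bochner_Integration.integral_sum)
        (auto intro!: int integrable_mult_right Bochner_Integration.integrable_sum simp del: times_divide_eq_left)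
    also have "\<dots> = (\<integral>J. 2 / Z (w (c t) J) * (\<Sum>k\<in>K. \<Sum>l\<in>K. d k * d l * (cov k l (w (c t) J))\<^sup>2) \<partial>M)"
      by (intro Bochner_Integration.integral_cong refl) (simp add: sum_distrib_left mult_ac)
    also have "0 \<le> \<kappa> t * \<dots>"
      by (intro mult_nonneg_nonneg \<kappa> t Bochner_Integration.integral_nonneg cov_square_psd)
        (auto intro: less_imp_le w_pos Z_w_pos)
    finally show ?thesis .
  qed
  have H_mono: "H t0 \<le> H t" if "t0 \<le> t" "t \<le> t1" for t
    by (rule DERIV_nonneg_imp_nondecreasing[OF that(1)]) (use that H_deriv H'_nonneg in \<open>blast intro: order_trans\<close>)
  \<comment> \<open>Subtracting the tangent directly avoids inverting \<open>p\<close>, whose speed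
    \<open>\<kappa>\<close> may vanish; in the application it does so at both ends.\<close>
  have "G t0 - p t0 * H t0 \<le> G t1 - p t1 * H t0"
  proof (rule DERIV_nonneg_imp_nondecreasing[OF t01])
    fix t assume t: "t0 \<le> t" "t \<le> t1"
    have "((\<lambda>t. G t - p t * H t0) has_real_derivative \<kappa> t * H t - \<kappa> t * H t0) (at t)"
      by (intro DERIV_diff G' DERIV_cmult_right p)
    moreover have "0 \<le> \<kappa> t * H t - \<kappa> t * H t0"
      using mult_left_mono[OF H_mono[OF t] \<kappa>[OF t]] by simp
    ultimately show "\<exists>y. ((\<lambda>t. G t - p t * H t0) has_real_derivative y) (at t) \<and> 0 \<le> y" by blast
  qed
  then show ?thesis by (simp add: G_def H_def algebra_simps)
qed

end

end

section \<open>Gauge symmetry\<close>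

text \<open>\<open>\<pi>\<close> abstracts the spin flip by \<open>T\<close>, under which every
  interaction term is multiplicative. It allows any configuration to take the role of the planted
  one.\<close>

locale gauge_gibbs = gibbs K \<Omega> \<sigma>
  for K :: "'k set" and \<Omega> :: "'s set" and \<sigma> :: "'k \<Rightarrow> 's \<Rightarrow> real" +
  assumes gauge: "\<And>T. T \<in> \<Omega> \<Longrightarrow>
    \<exists>\<pi>. bij_betw \<pi> \<Omega> \<Omega> \<and> (\<forall>k\<in>K. \<forall>S\<in>\<Omega>. \<sigma> k (\<pi> S) = \<sigma> k T * \<sigma> k S)"
begin

lemma w_restrict: "w c (\<lambda>k\<in>K. f k) = w c f"
  by (simp add: w_def fun_eq_iff)

text \<open>Flipping the couplings by \<open>T\<close> gives \<open>S\<close> the weight that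
  \<open>\<pi> S\<close> had. A sum over all configurations does not notice this, while a mean picks
  up the sign of its spin at \<open>T\<close>.\<close>

lemma gauge_Z_mean:
  assumes T: "T \<in> \<Omega>"
  shows gauge_Z: "Z (w c (\<lambda>k\<in>K. \<sigma> k T * J k)) = Z (w c J)"
    and gauge_mean: "k \<in> K \<Longrightarrow> mean k (w c (\<lambda>k\<in>K. \<sigma> k T * J k)) = \<sigma> k T * mean k (w c J)"
proof -
  obtain \<pi> where \<pi>: "bij_betw \<pi> \<Omega> \<Omega>" "\<And>k S. k \<in> K \<Longrightarrow> S \<in> \<Omega> \<Longrightarrow> \<sigma> k (\<pi> S) = \<sigma> k T * \<sigma> k S"
    using gauge[OF T] by blast
  have w: "w c (\<lambda>k\<in>K. \<sigma> k T * J k) S = w c J (\<pi> S)" if "S \<in> \<Omega>" for S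
    unfolding w_restrict by (simp add: w_def \<pi>(2) that mult_ac)
  show Z_eq: "Z (w c (\<lambda>k\<in>K. \<sigma> k T * J k)) = Z (w c J)"
    unfolding Z_def by (subst sum.reindex_bij_betw[OF \<pi>(1), symmetric]) (simp add: w)
  assume k: "k \<in> K"
  have "(\<Sum>S\<in>\<Omega>. \<sigma> k S * w c (\<lambda>k\<in>K. \<sigma> k T * J k) S) = (\<Sum>S\<in>\<Omega>. \<sigma> k T * (\<sigma> k (\<pi> S) * w c J (\<pi> S)))"
  proof (intro sum.cong refl)
    fix S assume S: "S \<in> \<Omega>"
    have "\<sigma> k T * \<sigma> k (\<pi> S) = \<sigma> k S"
      using \<sigma>_sq[OF k T] by (simp add: \<pi>(2)[OF k S] mult.assoc[symmetric])
    then show "\<sigma> k S * w c (\<lambda>k\<in>K. \<sigma> k T * J k) S = \<sigma> k T * (\<sigma> k (\<pi> S) * w c J (\<pi> S))"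
      using w[OF S] by (simp add: mult.assoc[symmetric])
  qed
  also have "\<dots> = \<sigma> k T * (\<Sum>S\<in>\<Omega>. \<sigma> k S * w c J S)"
    by (simp add: sum_distrib_left[symmetric] sum.reindex_bij_betw[OF \<pi>(1), where g = "\<lambda>S. \<sigma> k S * w c J S"])
  finally show "mean k (w c (\<lambda>k\<in>K. \<sigma> k T * J k)) = \<sigma> k T * mean k (w c J)"
    unfolding mean_def Z_eq by simp
qed

text \<open>Couplings planted at means \<open>c\<close> have, after a flip by \<open>T\<close>, the
  law with means \<open>\<sigma> k T * c k\<close>, whose density is exactly the weight of
  \<open>T\<close>.\<close>

lemma integral_shift_gauge:
  assumes T: "T \<in> \<Omega>" and [measurable]: "\<Phi> \<in> borel_measurable M"
  shows "(\<integral>J. \<Phi> (\<lambda>k\<in>K. J k + c k) \<partial>M) = (\<integral>J. \<Phi> (\<lambda>k\<in>K. \<sigma> k T * J k) * w c J T \<partial>M)"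
proof -
  let ?\<Psi> = "\<lambda>J. \<Phi> (\<lambda>k\<in>K. \<sigma> k T * J k)"
  have s: "\<bar>\<sigma> k T\<bar> = 1" if "k \<in> K" for k using \<sigma>_abs[OF that T] .
  have "(\<integral>J. \<Phi> (\<lambda>k\<in>K. J k + c k) \<partial>M) = (\<integral>J. \<Phi> (\<lambda>k\<in>K. 1 * J k + c k) \<partial>M)" by simp
  also have "\<dots> = (\<integral>J. \<Phi> J * exp (\<Sum>k\<in>K. c k * J k - (c k)\<^sup>2 / 2) \<partial>M)"
    by (rule integral_std_normal_PiM_affine[OF finite_K]) auto
  \<comment> \<open>The tilted density depends on the shift alone, so the noise may be flipped while
    the means stay put.\<close>
  also have "\<dots> = (\<integral>J. \<Phi> (\<lambda>k\<in>K. \<sigma> k T * J k + c k) \<partial>M)"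
    by (rule integral_std_normal_PiM_affine[OF finite_K s, symmetric]) auto
  also have "\<dots> = (\<integral>J. ?\<Psi> (\<lambda>k\<in>K. 1 * J k + \<sigma> k T * c k) \<partial>M)"
  proof (intro Bochner_Integration.integral_cong refl arg_cong[of _ _ \<Phi>] restrict_ext)
    fix J k assume k: "k \<in> K"
    show "\<sigma> k T * J k + c k = \<sigma> k T * (\<lambda>k\<in>K. 1 * J k + \<sigma> k T * c k) k"
      using k \<sigma>_sq[OF k T] by (simp add: distrib_left mult.assoc[symmetric])
  qed
  also have "\<dots> = (\<integral>J. ?\<Psi> J * exp (\<Sum>k\<in>K. \<sigma> k T * c k * J k - (\<sigma> k T * c k)\<^sup>2 / 2) \<partial>M)"
    by (rule integral_std_normal_PiM_affine[OF finite_K]) auto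
  also have "\<dots> = (\<integral>J. ?\<Psi> J * w c J T \<partial>M)"
    unfolding w_def using \<sigma>_sq[OF _ T]
    by (intro Bochner_Integration.integral_cong refl arg_cong2[of _ _ _ _ "(*)"] arg_cong[of _ _ exp] sum.cong)
      (simp add: power_mult_distrib power2_eq_square[of "\<sigma> _ T"])
  finally show ?thesis .
qed

text \<open>The planted expectation is written once for each configuration \<open>T\<close> and
  summed, hence the factor \<open>card \<Omega>\<close>. The weights of all \<open>T\<close> add up
  to \<open>Z\<close>. For the mean the sign \<open>\<sigma> k T\<close> survives, and the signed
  weights add up to \<open>mean k * Z\<close>, which supplies the second power.\<close>

lemma
  fixes c :: "'k \<Rightarrow> real"
  shows nishimori_ln_Z: "real (card \<Omega>) * (\<integral>J. ln (Z (w c (\<lambda>k. J k + c k))) \<partial>M)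
      = (\<integral>J. Z (w c J) * ln (Z (w c J)) \<partial>M)"
    and nishimori_mean: "k \<in> K \<Longrightarrow> real (card \<Omega>) * (\<integral>J. mean k (w c (\<lambda>k. J k + c k)) \<partial>M)
      = (\<integral>J. (mean k (w c J))\<^sup>2 * Z (w c J) \<partial>M)"
proof -
  have "\<exists>b. \<forall>k\<in>K. \<bar>c k\<bar> \<le> b"
    using finite_K by (intro exI[of _ "\<Sum>k\<in>K. \<bar>c k\<bar>"]) (auto intro: member_le_sum[of _ K "\<lambda>k. \<bar>c k\<bar>"])
  then obtain b where "\<forall>k\<in>K. \<bar>c k\<bar> \<le> b" by blast
  then have b: "\<And>t::unit. \<And>k. k \<in> K \<Longrightarrow> \<bar>(\<lambda>_. c) t k\<bar> \<le> b" by blast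
  note bd = exp_bounded_mult exp_bounded_const exp_bounded_w[where c = "\<lambda>_::unit. c", OF b]
    exp_bounded_ln_Z[where c = "\<lambda>_::unit. c", OF b] exp_bounded_mean[where c = "\<lambda>_::unit. c", OF b]
  have int: "integrable M (\<lambda>J. ln (Z (w c J)) * w c J T)" if "T \<in> \<Omega>" for T
  proof -
    have "exp_bounded K (\<lambda>_::unit. \<lambda>J. ln (Z (w c J)) * w c J T)"
      by (intro bd that)
    then show ?thesis by (rule integrable_exp_bounded[OF finite_K]) measurable
  qed
  have "real (card \<Omega>) * (\<integral>J. ln (Z (w c (\<lambda>k. J k + c k))) \<partial>M)
      = (\<Sum>T\<in>\<Omega>. \<integral>J. ln (Z (w c (\<lambda>k\<in>K. J k + c k))) \<partial>M)"
    by (simp add: w_restrict)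
  also have "\<dots> = (\<Sum>T\<in>\<Omega>. \<integral>J. ln (Z (w c J)) * w c J T \<partial>M)"
  proof (intro sum.cong refl)
    fix T assume T: "T \<in> \<Omega>"
    have [measurable]: "(\<lambda>J. ln (Z (w c J))) \<in> borel_measurable M" by measurable
    show "(\<integral>J. ln (Z (w c (\<lambda>k\<in>K. J k + c k))) \<partial>M) = (\<integral>J. ln (Z (w c J)) * w c J T \<partial>M)"
      using integral_shift_gauge[OF T, of "\<lambda>J. ln (Z (w c J))" c] by (simp add: gauge_Z[OF T])
  qed
  also have "\<dots> = (\<integral>J. (\<Sum>T\<in>\<Omega>. ln (Z (w c J)) * w c J T) \<partial>M)"
    by (rule Bochner_Integration.integral_sum[symmetric]) (rule int)
  also have "\<dots> = (\<integral>J. Z (w c J) * ln (Z (w c J)) \<partial>M)"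
    by (simp add: Z_def sum_distrib_right mult.commute)
  finally show "real (card \<Omega>) * (\<integral>J. ln (Z (w c (\<lambda>k. J k + c k))) \<partial>M)
      = (\<integral>J. Z (w c J) * ln (Z (w c J)) \<partial>M)" .
  assume k: "k \<in> K"
  have int: "integrable M (\<lambda>J. \<sigma> k T * mean k (w c J) * w c J T)" if "T \<in> \<Omega>" for T
  proof -
    have "exp_bounded K (\<lambda>_::unit. \<lambda>J. \<sigma> k T * mean k (w c J) * w c J T)"
      by (intro bd that k)
    then show ?thesis by (rule integrable_exp_bounded[OF finite_K]) measurable
  qed
  have "real (card \<Omega>) * (\<integral>J. mean k (w c (\<lambda>k. J k + c k)) \<partial>M)
      = (\<Sum>T\<in>\<Omega>. \<integral>J. mean k (w c (\<lambda>k\<in>K. J k + c k)) \<partial>M)"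
    by (simp add: w_restrict)
  also have "\<dots> = (\<Sum>T\<in>\<Omega>. \<integral>J. \<sigma> k T * mean k (w c J) * w c J T \<partial>M)"
  proof (intro sum.cong refl)
    fix T assume T: "T \<in> \<Omega>"
    show "(\<integral>J. mean k (w c (\<lambda>k\<in>K. J k + c k)) \<partial>M) = (\<integral>J. \<sigma> k T * mean k (w c J) * w c J T \<partial>M)"
      using integral_shift_gauge[OF T, of "\<lambda>J. mean k (w c J)" c] by (simp add: gauge_mean[OF T k])
  qed
  also have "\<dots> = (\<integral>J. (\<Sum>T\<in>\<Omega>. \<sigma> k T * mean k (w c J) * w c J T) \<partial>M)"
    by (rule Bochner_Integration.integral_sum[symmetric]) (rule int)
  also have "\<dots> = (\<integral>J. (mean k (w c J))\<^sup>2 * Z (w c J) \<partial>M)"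
  proof (intro Bochner_Integration.integral_cong refl)
    fix J
    have "(\<Sum>T\<in>\<Omega>. \<sigma> k T * mean k (w c J) * w c J T) = mean k (w c J) * (\<Sum>T\<in>\<Omega>. \<sigma> k T * w c J T)"
      by (simp add: sum_distrib_left mult_ac)
    then show "(\<Sum>T\<in>\<Omega>. \<sigma> k T * mean k (w c J) * w c J T) = (mean k (w c J))\<^sup>2 * Z (w c J)"
      by (simp add: mean_mult_Z[OF Z_w_pos, symmetric] power2_eq_square)
  qed
  finally show "real (card \<Omega>) * (\<integral>J. mean k (w c (\<lambda>k. J k + c k)) \<partial>M)
      = (\<integral>J. (mean k (w c J))\<^sup>2 * Z (w c J) \<partial>M)" .
qed

end

section \<open>Spin configurations\<close>

lemma spin_configs_cases:
  "S \<in> spin_configs V \<Longrightarrow> i \<in> V \<Longrightarrow> S i = -1 \<or> S i = 1"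
  unfolding spin_configs_def by (drule PiE_mem) auto

lemma spin_flip_bij_betw:
  assumes T: "T \<in> spin_configs V"
  shows "bij_betw (\<lambda>S. \<lambda>i\<in>V. T i * S i) (spin_configs V) (spin_configs V)"
proof (rule bij_betw_byWitness[where f' = "\<lambda>S. \<lambda>i\<in>V. T i * S i"])
  have TT: "T i * T i = 1" if "i \<in> V" for i using spin_configs_cases[OF T that] by auto
  show "\<forall>S\<in>spin_configs V. (\<lambda>i\<in>V. T i * (\<lambda>i\<in>V. T i * S i) i) = S"
  proof
    fix S assume "S \<in> spin_configs V"
    then have "S \<in> extensional V" by (auto simp: spin_configs_def PiE_iff)
    then show "(\<lambda>i\<in>V. T i * (\<lambda>i\<in>V. T i * S i) i) = S"
      by (auto simp: fun_eq_iff mult.assoc[symmetric] TT extensional_def)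
  qed
  then show "\<forall>S\<in>spin_configs V. (\<lambda>i\<in>V. T i * (\<lambda>i\<in>V. T i * S i) i) = S" .
  have "(\<lambda>i\<in>V. T i * S i) \<in> spin_configs V" if S: "S \<in> spin_configs V" for S
  proof -
    have "T i * S i \<in> {-1, 1}" if "i \<in> V" for i
      using spin_configs_cases[OF T that] spin_configs_cases[OF S that] by auto
    then show ?thesis by (auto simp: spin_configs_def PiE_iff)
  qed
  then show "(\<lambda>S. \<lambda>i\<in>V. T i * S i) ` spin_configs V \<subseteq> spin_configs V"
    and "(\<lambda>S. \<lambda>i\<in>V. T i * S i) ` spin_configs V \<subseteq> spin_configs V" by auto
qed

lemma gauge_gibbs_spin_configs:
  assumes V: "finite V" and K: "finite K" and A: "\<And>k. k \<in> K \<Longrightarrow> A k \<subseteq> V"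
  shows "gauge_gibbs K (spin_configs V) (\<lambda>k S. \<Prod>i\<in>A k. S i)"
proof unfold_locales
  show "finite K" by fact
  show "finite (spin_configs V)" unfolding spin_configs_def using V by (intro finite_PiE) auto
  show "spin_configs V \<noteq> {}" unfolding spin_configs_def by (simp add: PiE_eq_empty_iff)
  show "(\<Prod>i\<in>A k. S i) * (\<Prod>i\<in>A k. S i) = 1" if "k \<in> K" "S \<in> spin_configs V" for k S
  proof -
    have "S i * S i = 1" if "i \<in> A k" for i
      using spin_configs_cases[OF \<open>S \<in> spin_configs V\<close>, of i] A[OF \<open>k \<in> K\<close>] that by force
    then show ?thesis by (simp add: prod.distrib[symmetric])
  qed
  show "\<exists>\<pi>. bij_betw \<pi> (spin_configs V) (spin_configs V) \<and>
      (\<forall>k\<in>K. \<forall>S\<in>spin_configs V. (\<Prod>i\<in>A k. \<pi> S i) = (\<Prod>i\<in>A k. T i) * (\<Prod>i\<in>A k. S i))"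
    if "T \<in> spin_configs V" for T
  proof (intro exI conjI ballI)
    show "bij_betw (\<lambda>S. \<lambda>i\<in>V. T i * S i) (spin_configs V) (spin_configs V)"
      by (rule spin_flip_bij_betw[OF that])
    fix k S assume "k \<in> K"
    show "(\<Prod>i\<in>A k. (\<lambda>i\<in>V. T i * S i) i) = (\<Prod>i\<in>A k. T i) * (\<Prod>i\<in>A k. S i)"
      unfolding prod.distrib[symmetric] using A[OF \<open>k \<in> K\<close>] by (intro prod.cong) auto
  qed
qed

text \<open>Embeds one model, through \<open>\<iota>\<close>, into a larger family of couplings in
  which the others vanish. The index \<open>k\<close> ranges over all of \<open>K\<close>, so
  averages of spin products with zero coupling are covered too.\<close>

lemma
  fixes V :: "'v set" and K :: "'k set" and \<sigma> :: "'k \<Rightarrow> ('v \<Rightarrow> real) \<Rightarrow> real" and \<iota> :: "'v set \<Rightarrow> 'k"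
    and c :: "'k \<Rightarrow> real" and x :: "'v set \<Rightarrow> real"
  defines "w \<equiv> gibbs.w K \<sigma> c" and "Z \<equiv> gibbs.Z (spin_configs V)"
    and "mean \<equiv> gibbs.mean (spin_configs V) \<sigma>"
  assumes G: "gauge_gibbs K (spin_configs V) \<sigma>"
    and \<iota>: "inj_on \<iota> As" "\<iota> ` As \<subseteq> K"
    and x: "\<And>A. A \<in> As \<Longrightarrow> 0 \<le> x A"
    and c: "\<And>A. A \<in> As \<Longrightarrow> c (\<iota> A) = sqrt (x A)" "\<And>k. k \<in> K \<Longrightarrow> k \<notin> \<iota> ` As \<Longrightarrow> c k = 0"
    and \<sigma>: "\<And>A S. A \<in> As \<Longrightarrow> \<sigma> (\<iota> A) S = (\<Prod>i\<in>A. S i)"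
  shows expectation_ln_part_fun: "(\<integral>J. ln (part_fun V As x (J \<circ> \<iota>)) \<partial>std_normal_PiM K)
      = (\<Sum>A\<in>As. x A) / 2 + (\<integral>J. Z (w J) * ln (Z (w J)) \<partial>std_normal_PiM K) / real (card (spin_configs V))"
    and expectation_gibbs_avg: "k \<in> K \<Longrightarrow> (\<integral>J. gibbs_avg V As x (J \<circ> \<iota>) (\<sigma> k) \<partial>std_normal_PiM K)
      = (\<integral>J. (mean k (w J))\<^sup>2 * Z (w J) \<partial>std_normal_PiM K) / real (card (spin_configs V))"
    and integrable_gibbs_avg: "k \<in> K \<Longrightarrow>
      integrable (std_normal_PiM K) (\<lambda>J. gibbs_avg V As x (J \<circ> \<iota>) (\<sigma> k))"
proof -
  interpret g: gauge_gibbs K "spin_configs V" \<sigma> by (rule G)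
  \<comment> \<open>The normalisation of the likelihood ratios: it accounts for the term
    \<open>(\<Sum>A\<in>As. x A) / 2\<close> in the logarithm and cancels in Gibbs averages.\<close>
  let ?e = "exp (- (\<Sum>A\<in>As. x A) / 2)"
  let ?sh = "\<lambda>J k. J k + c k"
  have w_eq: "w (?sh J) S = ?e * boltz As x (J \<circ> \<iota>) S" for J S
  proof -
    have "(\<Sum>k\<in>K. c k * \<sigma> k S * (J k + c k) - (c k)\<^sup>2 / 2)
        = (\<Sum>k\<in>\<iota> ` As. c k * \<sigma> k S * (J k + c k) - (c k)\<^sup>2 / 2)"
      using \<iota>(2) g.finite_K by (intro sum.mono_neutral_right) (auto simp: c(2))
    also have "\<dots> = (\<Sum>A\<in>As. (sqrt (x A) * J (\<iota> A) + x A) * (\<Prod>i\<in>A. S i) - x A / 2)"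
      unfolding sum.reindex[OF \<iota>(1)] using x
      by (intro sum.cong refl) (simp add: c(1) \<sigma> algebra_simps)
    also have "\<dots> = - (\<Sum>A\<in>As. x A) / 2 + (\<Sum>A\<in>As. (sqrt (x A) * J (\<iota> A) + x A) * (\<Prod>i\<in>A. S i))"
      by (simp add: sum_subtractf sum_divide_distrib)
    finally show ?thesis by (simp only: w_def g.w_def boltz_def exp_add o_apply)
  qed
  have Z_eq: "Z (w (?sh J)) = ?e * part_fun V As x (J \<circ> \<iota>)" for J
    by (simp add: Z_def g.Z_def w_eq part_fun_def sum_distrib_left)
  have mean_eq: "mean k (w (?sh J)) = gibbs_avg V As x (J \<circ> \<iota>) (\<sigma> k)" for J k
  proof -
    have "(\<Sum>S\<in>spin_configs V. \<sigma> k S * w (?sh J) S)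
        = ?e * (\<Sum>S\<in>spin_configs V. \<sigma> k S * boltz As x (J \<circ> \<iota>) S)"
      by (simp add: w_eq sum_distrib_left mult.left_commute)
    then show ?thesis
      by (simp add: mean_def g.mean_def Z_eq[unfolded Z_def] gibbs_avg_def)
  qed
  have part_pos: "0 < part_fun V As x J" for J
    unfolding part_fun_def using g.finite_\<Omega> g.\<Omega>_ne by (intro sum_pos) (auto simp: boltz_def)
  have ln_eq: "ln (part_fun V As x (J \<circ> \<iota>)) = (\<Sum>A\<in>As. x A) / 2 + ln (Z (w (?sh J)))" for J
    unfolding Z_eq using part_pos[of "J \<circ> \<iota>"] by (simp add: ln_mult)
  have cb: "\<bar>c k\<bar> \<le> (\<Sum>k\<in>K. \<bar>c k\<bar>)" if "k \<in> K" for k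
    using that g.finite_K by (intro member_le_sum) auto
  have N: "real (card (spin_configs V)) > 0"
    using g.finite_\<Omega> g.\<Omega>_ne by (simp add: card_gt_0_iff)
  have "integrable (std_normal_PiM K) (\<lambda>J. ln (Z (w (?sh J))))"
  proof (rule integrable_exp_bounded[OF g.finite_K])
    show "exp_bounded K (\<lambda>_::unit. \<lambda>J. ln (Z (w (?sh J))))"
      unfolding Z_def w_def by (intro exp_bounded_shift g.exp_bounded_ln_Z[where c = "\<lambda>_. c" and b = "\<Sum>k\<in>K. \<bar>c k\<bar>"] cb)
    show "(\<lambda>J. ln (Z (w (?sh J)))) \<in> borel_measurable (std_normal_PiM K)"
      unfolding Z_def g.Z_def w_def g.w_def by measurable
  qed
  then have "(\<integral>J. ln (part_fun V As x (J \<circ> \<iota>)) \<partial>std_normal_PiM K)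
      = (\<Sum>A\<in>As. x A) / 2 + (\<integral>J. ln (Z (w (?sh J))) \<partial>std_normal_PiM K)"
    unfolding ln_eq
    by (simp add: Bochner_Integration.integral_add prob_space.prob_space prob_space_PiM prob_space_std_normal
        prob_space.finite_measure finite_measure.integrable_const)
  then show "(\<integral>J. ln (part_fun V As x (J \<circ> \<iota>)) \<partial>std_normal_PiM K)
      = (\<Sum>A\<in>As. x A) / 2 + (\<integral>J. Z (w J) * ln (Z (w J)) \<partial>std_normal_PiM K) / real (card (spin_configs V))"
    using g.nishimori_ln_Z[of c] N by (simp add: Z_def w_def eq_divide_eq mult.commute)
  assume k: "k \<in> K"
  show "(\<integral>J. gibbs_avg V As x (J \<circ> \<iota>) (\<sigma> k) \<partial>std_normal_PiM K)
      = (\<integral>J. (mean k (w J))\<^sup>2 * Z (w J) \<partial>std_normal_PiM K) / real (card (spin_configs V))"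
    unfolding mean_eq[symmetric] using g.nishimori_mean[OF k, of c] N
    by (simp add: mean_def Z_def w_def eq_divide_eq mult.commute)
  have "exp_bounded K (\<lambda>_::unit. \<lambda>J. mean k (w (?sh J)))"
    unfolding mean_def w_def
    by (intro exp_bounded_shift g.exp_bounded_mean[where c = "\<lambda>_. c" and b = "\<Sum>k\<in>K. \<bar>c k\<bar>"] cb k)
  moreover have "(\<lambda>J. mean k (w (?sh J))) \<in> borel_measurable (std_normal_PiM K)"
    unfolding mean_def g.mean_def g.Z_def w_def g.w_def by measurable
  ultimately have "integrable (std_normal_PiM K) (\<lambda>J. mean k (w (?sh J)))"
    by (rule integrable_exp_bounded[OF g.finite_K])
  then show "integrable (std_normal_PiM K) (\<lambda>J. gibbs_avg V As x (J \<circ> \<iota>) (\<sigma> k))"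
    unfolding mean_eq .
qed

section \<open>Interpolation between the two models\<close>

theorem theorem2:
  fixes V :: "'v set" and A1 A0 :: "'v set set" and x1 x0 :: "'v set \<Rightarrow> real"
  assumes "finite V"
    and "finite A1" and "finite A0"
    and "\<forall>A\<in>A1. A \<subseteq> V \<and> A \<noteq> {}"
    and "\<forall>B\<in>A0. B \<subseteq> V \<and> B \<noteq> {}"
    and "\<forall>A\<in>A1. 0 \<le> x1 A"
    and "\<forall>B\<in>A0. 0 \<le> x0 B"
  shows "(\<integral>J. ln (part_fun V A1 x1 (J \<circ> Inl)) \<partial>gauss_env A1 A0)
    \<ge> (\<integral>J. ln (part_fun V A0 x0 (J \<circ> Inr)) \<partial>gauss_env A1 A0)
      + (\<integral>J. (1/2) * (\<Sum>A\<in>A1. x1 A * (1 + gibbs_avg V A0 x0 (J \<circ> Inr) (\<lambda>S. \<Prod>i\<in>A. S i)))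
             - (1/2) * (\<Sum>B\<in>A0. x0 B * (1 + gibbs_avg V A0 x0 (J \<circ> Inr) (\<lambda>S. \<Prod>i\<in>B. S i)))
          \<partial>gauss_env A1 A0)"
proof -
  define K :: "('v set + 'v set) set" where "K = Inl ` A1 \<union> Inr ` A0"
  define \<sigma> :: "'v set + 'v set \<Rightarrow> ('v \<Rightarrow> real) \<Rightarrow> real"
    where "\<sigma> = (\<lambda>k S. \<Prod>i\<in>case_sum id id k. S i)"
  \<comment> \<open>The trigonometric path keeps the square roots of the couplings smooth at both ends.\<close>
  define c where "c t = case_sum (\<lambda>A. sqrt (x1 A) * sin t) (\<lambda>B. sqrt (x0 B) * cos t)" for t
  define c' where "c' t = case_sum (\<lambda>A. sqrt (x1 A) * cos t) (\<lambda>B. - (sqrt (x0 B) * sin t))" for t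
  \<comment> \<open>The constant direction of the segment: the left squared couplings grow from 0 to
    \<open>x1\<close>, the right ones fall from \<open>x0\<close> to 0.\<close>
  define d where "d = case_sum x1 (\<lambda>B. - x0 B)"
  have K: "finite K" using assms(2,3) by (simp add: K_def)
  have sumK: "(\<Sum>k\<in>K. f k) = (\<Sum>A\<in>A1. f (Inl A)) + (\<Sum>B\<in>A0. f (Inr B))" for f :: "'v set + 'v set \<Rightarrow> real"
    unfolding K_def using assms(2,3) by (subst sum.union_disjoint) (auto simp: sum.reindex)
  have G: "gauge_gibbs K (spin_configs V) \<sigma>"
    unfolding \<sigma>_def by (rule gauge_gibbs_spin_configs) (use assms K in \<open>auto simp: K_def\<close>)
  interpret g: gauge_gibbs K "spin_configs V" \<sigma> by (rule G)
  let ?N = "real (card (spin_configs V))"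
  let ?G = "\<lambda>t. \<integral>J. g.Z (g.w (c t) J) * ln (g.Z (g.w (c t) J)) \<partial>g.M"
  let ?m = "\<lambda>k. \<integral>J. (g.mean k (g.w (c 0) J))\<^sup>2 * g.Z (g.w (c 0) J) \<partial>g.M"
  let ?H = "\<Sum>k\<in>K. d k * ?m k"
  let ?b = "\<Sum>k\<in>K. \<bar>case_sum (\<lambda>A. sqrt (x1 A)) (\<lambda>B. sqrt (x0 B)) k\<bar>"
  have b: "\<bar>case_sum (\<lambda>A. sqrt (x1 A)) (\<lambda>B. sqrt (x0 B)) k\<bar> \<le> ?b" if "k \<in> K" for k
    using that K by (intro member_le_sum) auto
  have trig: "\<bar>a * sin t\<bar> \<le> \<bar>a\<bar>" "\<bar>a * cos t\<bar> \<le> \<bar>a\<bar>" for a t :: real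
    using mult_left_mono[OF abs_sin_le_one abs_ge_zero, of a t] mult_left_mono[OF abs_cos_le_one abs_ge_zero, of a t]
    by (simp_all add: abs_mult)
  \<comment> \<open>With \<open>p t = (sin t)\<^sup>2 / 2\<close> the total increment of
    \<open>p\<close> is 1/2, the constant in front of both sums of the claim.\<close>
  have "((sin (pi / 2))\<^sup>2 / 2 - (sin 0)\<^sup>2 / 2) * ?H \<le> ?G (pi / 2) - ?G 0"
  proof (rule g.entropy_gradient_inequality)
    show "((\<lambda>t. c t k) has_real_derivative c' t k) (at t)" for t k
      by (cases k) (auto simp: c_def c'_def intro!: derivative_eq_intros)
    show "\<bar>c t k\<bar> \<le> ?b" if "k \<in> K" for t k
      by (rule order_trans[OF _ b[OF that]]) (cases k; simp only: c_def sum.case trig)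
    show "\<bar>c' t k\<bar> \<le> ?b" if "k \<in> K" for t k
      by (rule order_trans[OF _ b[OF that]]) (cases k; simp only: c'_def sum.case abs_minus_cancel trig)
    show "c t k * c' t k = (sin t * cos t) * d k" if "k \<in> K" for t k
      using that assms(6,7) by (auto simp: K_def c_def c'_def d_def)
    show "((\<lambda>t. (sin t)\<^sup>2 / 2) has_real_derivative sin t * cos t) (at t)" for t :: real
      by (auto intro!: derivative_eq_intros)
    show "0 \<le> sin t * cos t" if "0 \<le> t" "t \<le> pi / 2" for t :: real
      using that by (intro mult_nonneg_nonneg sin_ge_zero cos_ge_zero) auto
  qed simp
  then have main: "?H / 2 \<le> ?G (pi / 2) - ?G 0" by simp
  have N: "0 < ?N" using g.finite_\<Omega> g.\<Omega>_ne by (simp add: card_gt_0_iff)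
  have env: "gauss_env A1 A0 = g.M" by (simp add: gauss_env_def K_def)
  \<comment> \<open>At time \<open>pi / 2\<close> the right couplings vanish and the left ones equal
    \<open>sqrt (x1 A)\<close>; time 0 is the mirror image.\<close>
  have ln1: "(\<integral>J. ln (part_fun V A1 x1 (J \<circ> Inl)) \<partial>g.M) = (\<Sum>A\<in>A1. x1 A) / 2 + ?G (pi / 2) / ?N"
    by (rule expectation_ln_part_fun[OF G]) (use assms(6) in \<open>auto simp: K_def c_def \<sigma>_def\<close>)
  have c0: "c 0 (Inr B) = sqrt (x0 B)" "k \<in> K \<Longrightarrow> k \<notin> Inr ` A0 \<Longrightarrow> c 0 k = 0" for B k
    by (auto simp: K_def c_def)
  have \<sigma>_Inr: "\<sigma> (Inr B) S = (\<Prod>i\<in>B. S i)" for B S by (simp add: \<sigma>_def)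
  have sub: "Inr ` A0 \<subseteq> K" by (simp add: K_def)
  have ln0: "(\<integral>J. ln (part_fun V A0 x0 (J \<circ> Inr)) \<partial>g.M) = (\<Sum>B\<in>A0. x0 B) / 2 + ?G 0 / ?N"
    by (rule expectation_ln_part_fun[OF G]) (use assms(7) sub c0 \<sigma>_Inr in auto)
  \<comment> \<open>Needed also for \<open>k = Inl A\<close>, an index whose coupling is 0 at time
    0: these are the averages over \<open>A1\<close> in the claim.\<close>
  have avg: "(\<integral>J. gibbs_avg V A0 x0 (J \<circ> Inr) (\<sigma> k) \<partial>g.M) = ?m k / ?N" if "k \<in> K" for k
    by (rule expectation_gibbs_avg[OF G]) (use assms(7) sub c0 \<sigma>_Inr that in auto)
  have avg_int: "integrable g.M (\<lambda>J. gibbs_avg V A0 x0 (J \<circ> Inr) (\<sigma> k))" if "k \<in> K" for k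
    by (rule integrable_gibbs_avg[OF G, where c = "c 0"]) (use assms(7) sub c0 \<sigma>_Inr that in auto)
  interpret M: prob_space g.M
    by (intro prob_space_PiM prob_space_std_normal)
  have "(\<integral>J. (1/2) * (\<Sum>A\<in>A1. x1 A * (1 + gibbs_avg V A0 x0 (J \<circ> Inr) (\<lambda>S. \<Prod>i\<in>A. S i)))
             - (1/2) * (\<Sum>B\<in>A0. x0 B * (1 + gibbs_avg V A0 x0 (J \<circ> Inr) (\<lambda>S. \<Prod>i\<in>B. S i))) \<partial>g.M)
      = (\<integral>J. (\<Sum>k\<in>K. d k / 2 * (1 + gibbs_avg V A0 x0 (J \<circ> Inr) (\<sigma> k))) \<partial>g.M)"
    by (intro Bochner_Integration.integral_cong refl)
      (simp add: sumK d_def \<sigma>_def sum_distrib_left sum_negf)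
  also have "\<dots> = (\<Sum>k\<in>K. d k / 2 * (1 + ?m k / ?N))"
  proof -
    have "(\<integral>J. (\<Sum>k\<in>K. d k / 2 * (1 + gibbs_avg V A0 x0 (J \<circ> Inr) (\<sigma> k))) \<partial>g.M)
        = (\<Sum>k\<in>K. \<integral>J. d k / 2 * (1 + gibbs_avg V A0 x0 (J \<circ> Inr) (\<sigma> k)) \<partial>g.M)"
      by (rule Bochner_Integration.integral_sum) (simp add: avg_int)
    also have "\<dots> = (\<Sum>k\<in>K. d k / 2 * (1 + ?m k / ?N))"
      by (intro sum.cong refl) (simp add: avg_int avg M.prob_space)
    finally show ?thesis .
  qed
  \<comment> \<open>The constant part matches the normalisation terms in \<open>ln1\<close> and
    \<open>ln0\<close>, leaving exactly the tangent inequality divided by the number of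
    configurations.\<close>
  also have "\<dots> = (\<Sum>A\<in>A1. x1 A) / 2 - (\<Sum>B\<in>A0. x0 B) / 2 + (?H / 2) / ?N"
  proof -
    have "(\<Sum>k\<in>K. d k / 2 * (1 + ?m k / ?N)) = (\<Sum>k\<in>K. d k) / 2 + (?H / 2) / ?N"
      by (simp add: sum_divide_distrib sum.distrib distrib_left)
    moreover have "(\<Sum>k\<in>K. d k) = (\<Sum>A\<in>A1. x1 A) - (\<Sum>B\<in>A0. x0 B)"
      by (simp add: sumK d_def sum_negf)
    ultimately show ?thesis by (simp only: diff_divide_distrib)
  qed
  finally show ?thesis
    unfolding env ln1 ln0 using divide_right_mono[OF main less_imp_le[OF N]]
    by (simp add: diff_divide_distrib)
qed

end
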